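(* Let $S$ and $T$ be countable (discrete) strongly Morita equivalent inverse semigroups. Then their universal groupoids $\mathscr G(S)$ and $\mathscr G(T)$ are Morita equivalent as étale groupoids.
   Context: An inverse semigroup is a semigroup $S$ such that for each $s\in S$ there is a unique $s^*\in S$ with $ss^*s=s$ and $s^*ss^*=s^*$; $E(S)$ is its (commutative) set of idempotents; $s\le t$ means $s=et$ for some $e\in E(S)$. A Morita context is a 5-tuple $(S,T,X,\langle\ ,\ \rangle,[\ ,\ ])$ where $S,T$ are inverse semigroups, $X$ is a set with a left action of $S$ and a right action of $T$ that commute, and $\langle\ ,\ \rangle\colon X\times X\to S$, $[\ ,\ ]\colon X\times X\to T$ are surjective functions such that for all $x,y,z\in X$, $s\in S$, $t\in T$: (1) $\langle sx,y\rangle=s\langle x,y\rangle$; (2) $\langle y,x\rangle=\langle x,y\rangle^*$; (3) $\langle x,x\rangle x=x$; (4) $[x,yt]=[x,y]t$; (5) $[y,x]=[x,y]^*$; (6) $x[x,x]=x$; (7) $\langle x,y\rangle z=x[y,z]$. $S$ and $T$ are strongly Morita equivalent if such a Morita context exists. Universal groupoid. Let $E=E(S)$ and let $\widehat E$ be the space of non-zero semigroup homomorphisms $\varphi\colon E\to\{0,1\}$ with the topology of pointwise convergence. For $e\in E$ put $D(e)=\{\varphi\in\widehat E\mid \varphi(e)=1\}$. Each $s\in S$ acts as a homeomorphism $D(s^*s)\to D(ss^* )$ by $(s\varphi)(e)=\varphi(s^*es)$. The groupoid $\mathscr G(S)$ has unit space $\widehat E$; its arrows are classes $\overline{(s,\varphi)}$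 with $s\in S$, $\varphi\in D(s^*s)$, where $(s,\varphi)$ and $(s',\psi)$ are equivalent iff $\varphi=\psi$ and there is $u\in S$ with $u\le s,s'$ and $\varphi\in D(u^*u)$. Domain and range: $d(\overline{(s,\varphi)})=\varphi$, $r(\overline{(s,\varphi)})=s\varphi$; product $\overline{(s,\varphi)}\cdot\overline{(s',\psi)}=\overline{(ss',\psi)}$ when $\varphi=s'\psi$; inverse $\overline{(s,\varphi)}^{-1}=\overline{(s^*,s\varphi)}$. A basis for the topology consists of the sets $\{\overline{(s,\varphi)}\mid\varphi\in U\}$ with $s\in S$ and $U\subseteq D(s^*s)$ open in $\widehat E$. Morita equivalence of groupoids. A locally compact space means a topological space with a basis of locally compact Hausdorff spaces (not necessarily Hausdorff itself). An étale groupoid is a topological groupoid with locally compact Hausdorff unit space whose domain map is a local homeomorphism. If $\mathscr G$ is a topological groupoid, $Z$ a locally compact space and $f\colon Z\to\mathscr G^0$ continuous, $\mathscr G[Z]$ is the topological groupoid with unit space $Z$ and arrows the triples $(z',g,z)$ with $z,z'\in Z$, $g\in\mathscr G$, $d(g)=f(z)$, $r(g)=f(z')$, with the subspace topology from $Z\times\mathscr G\times Z$, product $(z'',g',z')(z',g,z)=(z'',g'g,z)$ and inverse $(z',g,z)^{-1}=(z,g^{-1},z')$. Étale groupoids $\mathscr G_1,\mathscr G_2$ are Morita equivalent if there are a locally compact space $Z$ and continuous open surjections $f_i\colon Z\to\mathscr G_i^0$ ($i=1,2$) such that $\mathscr G_1[Z]$ and $\mathscr G_2[Z]$ are topologically isomorphic.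 *)

theory Defs
  imports "HOL-Analysis.Analysis" "HOL-Algebra.Congruence"
begin

section \<open>Inverse semigroups\<close>

record 'a sgrp = "'a partial_object" +
  mult :: "'a \<Rightarrow> 'a \<Rightarrow> 'a" (infixl \<open>\<otimes>\<index>\<close> 70)

locale inverse_semigroup =
  fixes S :: "('a, 'm) sgrp_scheme" (structure)
  assumes m_closed: "s \<in> carrier S \<Longrightarrow> t \<in> carrier S \<Longrightarrow> s \<otimes> t \<in> carrier S"
    and m_assoc: "s \<in> carrier S \<Longrightarrow> t \<in> carrier S \<Longrightarrow> u \<in> carrier S \<Longrightarrow>
      (s \<otimes> t) \<otimes> u = s \<otimes> (t \<otimes> u)"
    and ex1_star: "s \<in> carrier S \<Longrightarrow>
      \<exists>!t. t \<in> carrier S \<and> s \<otimes> t \<otimes> s = s \<and> t \<otimes> s \<otimes> t = t"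

definition star :: "('a, 'm) sgrp_scheme \<Rightarrow> 'a \<Rightarrow> 'a" where
  "star S s = (THE t. t \<in> carrier S \<and> s \<otimes>\<^bsub>S\<^esub> t \<otimes>\<^bsub>S\<^esub> s = s \<and> t \<otimes>\<^bsub>S\<^esub> s \<otimes>\<^bsub>S\<^esub> t = t)"

definition idems :: "('a, 'm) sgrp_scheme \<Rightarrow> 'a set" where
  "idems S = {e \<in> carrier S. e \<otimes>\<^bsub>S\<^esub> e = e}"

definition nat_le :: "('a, 'm) sgrp_scheme \<Rightarrow> 'a \<Rightarrow> 'a \<Rightarrow> bool" where
  "nat_le S s t \<longleftrightarrow> (\<exists>e\<in>idems S. s = e \<otimes>\<^bsub>S\<^esub> t)"


section \<open>Strong Morita equivalence of inverse semigroups\<close>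

locale morita_context =
  S: inverse_semigroup S + T: inverse_semigroup T
  for S :: "('s, 'm) sgrp_scheme" and T :: "('t, 'n) sgrp_scheme" +
  fixes X :: "'x set"
    and lact :: "'s \<Rightarrow> 'x \<Rightarrow> 'x"
    and ract :: "'x \<Rightarrow> 't \<Rightarrow> 'x"
    and lprod :: "'x \<Rightarrow> 'x \<Rightarrow> 's"
    and rprod :: "'x \<Rightarrow> 'x \<Rightarrow> 't"
  assumes lact_closed: "s \<in> carrier S \<Longrightarrow> x \<in> X \<Longrightarrow> lact s x \<in> X"
    and lact_mult: "s \<in> carrier S \<Longrightarrow> s' \<in> carrier S \<Longrightarrow> x \<in> X \<Longrightarrow>
      lact (s \<otimes>\<^bsub>S\<^esub> s') x = lact s (lact s' x)"
    and ract_closed: "t \<in> carrier T \<Longrightarrow> x \<in> X \<Longrightarrow> ract x t \<in> X"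
    and ract_mult: "t \<in> carrier T \<Longrightarrow> t' \<in> carrier T \<Longrightarrow> x \<in> X \<Longrightarrow>
      ract x (t \<otimes>\<^bsub>T\<^esub> t') = ract (ract x t) t'"
    and act_commute: "s \<in> carrier S \<Longrightarrow> t \<in> carrier T \<Longrightarrow> x \<in> X \<Longrightarrow>
      ract (lact s x) t = lact s (ract x t)"
    and lprod_onto: "(\<lambda>(x, y). lprod x y) ` (X \<times> X) = carrier S"
    and rprod_onto: "(\<lambda>(x, y). rprod x y) ` (X \<times> X) = carrier T"
    and lprod_lact: "s \<in> carrier S \<Longrightarrow> x \<in> X \<Longrightarrow> y \<in> X \<Longrightarrow>
      lprod (lact s x) y = s \<otimes>\<^bsub>S\<^esub> lprod x y"
    and lprod_star: "x \<in> X \<Longrightarrow> y \<in> X \<Longrightarrow> lprod y x = star S (lprod x y)"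
    and lprod_self: "x \<in> X \<Longrightarrow> lact (lprod x x) x = x"
    and rprod_ract: "t \<in> carrier T \<Longrightarrow> x \<in> X \<Longrightarrow> y \<in> X \<Longrightarrow>
      rprod x (ract y t) = rprod x y \<otimes>\<^bsub>T\<^esub> t"
    and rprod_star: "x \<in> X \<Longrightarrow> y \<in> X \<Longrightarrow> rprod y x = star T (rprod x y)"
    and rprod_self: "x \<in> X \<Longrightarrow> ract x (rprod x x) = x"
    and lprod_rprod: "x \<in> X \<Longrightarrow> y \<in> X \<Longrightarrow> z \<in> X \<Longrightarrow>
      lact (lprod x y) z = ract x (rprod y z)"

text \<open>HOL cannot quantify over types, so the type carrying the set \<open>X\<close> is a parameter. A theorem
  assuming this for an arbitrary \<open>'x\<close> covers every Morita context.\<close>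

definition strongly_morita_equivalent ::
  "'x itself \<Rightarrow> ('s, 'm) sgrp_scheme \<Rightarrow> ('t, 'n) sgrp_scheme \<Rightarrow> bool" where
  "strongly_morita_equivalent (_ :: 'x itself) S T \<longleftrightarrow>
    (\<exists>(X :: 'x set) lact ract lprod rprod. morita_context S T X lact ract lprod rprod)"


section \<open>Topological groupoids\<close>

text \<open>Arrows and units have separate types. \<open>gcomp G g h\<close> is the product \<open>gh\<close>, defined when
  \<open>d(g) = r(h)\<close>. In a topological groupoid \<open>gid\<close> is a topological embedding of the unit space,
  since \<open>gdom\<close> is a continuous left inverse of it.\<close>

record ('a, 'u) tgroupoid =
  arrows :: "'a topology"
  units :: "'u topology"
  gdom :: "'a \<Rightarrow> 'u"
  grng :: "'a \<Rightarrow> 'u"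
  gid :: "'u \<Rightarrow> 'a"
  gcomp :: "'a \<Rightarrow> 'a \<Rightarrow> 'a"
  ginv :: "'a \<Rightarrow> 'a"

definition composable :: "('a, 'u) tgroupoid \<Rightarrow> ('a \<times> 'a) set" where
  "composable G =
    {(g, h). g \<in> topspace (arrows G) \<and> h \<in> topspace (arrows G) \<and> gdom G g = grng G h}"

locale topological_groupoid =
  fixes G :: "('a, 'u) tgroupoid"
  assumes continuous_dom: "continuous_map (arrows G) (units G) (gdom G)"
    and continuous_rng: "continuous_map (arrows G) (units G) (grng G)"
    and continuous_id: "continuous_map (units G) (arrows G) (gid G)"
    and continuous_inv: "continuous_map (arrows G) (arrows G) (ginv G)"
    and continuous_comp: "continuous_map
      (subtopology (prod_topology (arrows G) (arrows G)) (composable G)) (arrows G)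
      (\<lambda>(g, h). gcomp G g h)"
    and dom_id: "u \<in> topspace (units G) \<Longrightarrow> gdom G (gid G u) = u"
    and rng_id: "u \<in> topspace (units G) \<Longrightarrow> grng G (gid G u) = u"
    and dom_comp: "(g, h) \<in> composable G \<Longrightarrow> gdom G (gcomp G g h) = gdom G h"
    and rng_comp: "(g, h) \<in> composable G \<Longrightarrow> grng G (gcomp G g h) = grng G g"
    and comp_assoc: "(g, h) \<in> composable G \<Longrightarrow> (h, k) \<in> composable G \<Longrightarrow>
      gcomp G (gcomp G g h) k = gcomp G g (gcomp G h k)"
    and comp_id_right: "g \<in> topspace (arrows G) \<Longrightarrow> gcomp G g (gid G (gdom G g)) = g"
    and comp_id_left: "g \<in> topspace (arrows G) \<Longrightarrow> gcomp G (gid G (grng G g)) g = g"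
    and dom_inv: "g \<in> topspace (arrows G) \<Longrightarrow> gdom G (ginv G g) = grng G g"
    and rng_inv: "g \<in> topspace (arrows G) \<Longrightarrow> grng G (ginv G g) = gdom G g"
    and comp_inv_left: "g \<in> topspace (arrows G) \<Longrightarrow>
      gcomp G (ginv G g) g = gid G (gdom G g)"
    and comp_inv_right: "g \<in> topspace (arrows G) \<Longrightarrow>
      gcomp G g (ginv G g) = gid G (grng G g)"

definition local_homeomorphism :: "'a topology \<Rightarrow> 'b topology \<Rightarrow> ('a \<Rightarrow> 'b) \<Rightarrow> bool" where
  "local_homeomorphism X Y f \<longleftrightarrow>
    (\<forall>x\<in>topspace X. \<exists>U. openin X U \<and> x \<in> U \<and> openin Y (f ` U) \<and>
      homeomorphic_map (subtopology X U) (subtopology Y (f ` U)) f)"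

definition lc_hausdorff :: "'a topology \<Rightarrow> bool" where
  "lc_hausdorff X \<longleftrightarrow> locally_compact_space X \<and> Hausdorff_space X"

text \<open>Locally compact in the non-Hausdorff sense, which differs from the library's
  \<^const>\<open>locally_compact_space\<close>.\<close>

definition locally_lc_hausdorff :: "'a topology \<Rightarrow> bool" where
  "locally_lc_hausdorff X \<longleftrightarrow>
    (\<exists>\<B>. openin X = arbitrary union_of (\<lambda>U. U \<in> \<B>) \<and>
      (\<forall>U\<in>\<B>. lc_hausdorff (subtopology X U)))"

definition etale_groupoid :: "('a, 'u) tgroupoid \<Rightarrow> bool" where
  "etale_groupoid G \<longleftrightarrow> topological_groupoid G \<and> lc_hausdorff (units G) \<and>
    local_homeomorphism (arrows G) (units G) (gdom G)"

definition pullback_groupoid ::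
  "('a, 'u) tgroupoid \<Rightarrow> 'z topology \<Rightarrow> ('z \<Rightarrow> 'u) \<Rightarrow> ('z \<times> 'a \<times> 'z, 'z) tgroupoid" where
  "pullback_groupoid G Z f =
    \<lparr> arrows = subtopology (prod_topology Z (prod_topology (arrows G) Z))
        {(z', g, z). gdom G g = f z \<and> grng G g = f z'},
      units = Z,
      gdom = (\<lambda>(z', g, z). z),
      grng = (\<lambda>(z', g, z). z'),
      gid = (\<lambda>z. (z, gid G (f z), z)),
      gcomp = (\<lambda>(z'', g', _) (_, g, z). (z'', gcomp G g' g, z)),
      ginv = (\<lambda>(z', g, z). (z, ginv G g, z')) \<rparr>"

text \<open>Preservation of inverses follows from preservation of products and identities.\<close>

definition topologically_isomorphic ::
  "('a, 'u) tgroupoid \<Rightarrow> ('b, 'v) tgroupoid \<Rightarrow> bool" where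
  "topologically_isomorphic G H \<longleftrightarrow>
    (\<exists>F F0. homeomorphic_map (arrows G) (arrows H) F \<and>
      homeomorphic_map (units G) (units H) F0 \<and>
      (\<forall>g\<in>topspace (arrows G). gdom H (F g) = F0 (gdom G g) \<and> grng H (F g) = F0 (grng G g)) \<and>
      (\<forall>u\<in>topspace (units G). F (gid G u) = gid H (F0 u)) \<and>
      (\<forall>(g, h)\<in>composable G. F (gcomp G g h) = gcomp H (F g) (F h)))"

definition open_surjection :: "'a topology \<Rightarrow> 'b topology \<Rightarrow> ('a \<Rightarrow> 'b) \<Rightarrow> bool" where
  "open_surjection X Y f \<longleftrightarrow>
    continuous_map X Y f \<and> open_map X Y f \<and> f ` topspace X = topspace Y"

text \<open>The space \<open>Z\<close> is carried by the type of pairs of arrows, since HOL cannot quantify over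
  types. This is no restriction: if \<open>G[Z]\<close> and \<open>H[Z]\<close> are isomorphic for some \<open>Z\<close>, then \<open>Z\<close> can be
  replaced by the associated principal \<open>G\<close>-\<open>H\<close>-bibundle \<open>P\<close>. It is locally homeomorphic to the unit
  space of \<open>G\<close>, with fibres that are \<open>H\<close>-torsors, so that choosing a base point in each fibre
  gives an injection from \<open>P\<close> into pairs of an arrow of \<open>G\<close> and an arrow of \<open>H\<close>.\<close>

definition morita_equivalent ::
  "('a, 'u) tgroupoid \<Rightarrow> ('b, 'v) tgroupoid \<Rightarrow> bool" where
  "morita_equivalent G H \<longleftrightarrow> etale_groupoid G \<and> etale_groupoid H \<and>
    (\<exists>(Z :: ('a \<times> 'b) topology) f1 f2. locally_lc_hausdorff Z \<and>
      open_surjection Z (units G) f1 \<and> open_surjection Z (units H) f2 \<and>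
      topologically_isomorphic (pullback_groupoid G Z f1) (pullback_groupoid H Z f2))"


section \<open>The universal groupoid of an inverse semigroup\<close>

text \<open>The multiplicative semigroup \<open>{0, 1}\<close> is rendered as \<^typ>\<open>bool\<close> with conjunction, and functions on
  the set of idempotents as extensional functions.\<close>

definition characters :: "('a, 'm) sgrp_scheme \<Rightarrow> ('a \<Rightarrow> bool) set" where
  "characters S =
    {\<phi> \<in> idems S \<rightarrow>\<^sub>E UNIV. (\<exists>e\<in>idems S. \<phi> e) \<and>
      (\<forall>e\<in>idems S. \<forall>f\<in>idems S. \<phi> (e \<otimes>\<^bsub>S\<^esub> f) = (\<phi> e \<and> \<phi> f))}"

definition character_space :: "('a, 'm) sgrp_scheme \<Rightarrow> ('a \<Rightarrow> bool) topology" where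
  "character_space S =
    subtopology (product_topology (\<lambda>_. discrete_topology UNIV) (idems S)) (characters S)"

definition char_dom :: "('a, 'm) sgrp_scheme \<Rightarrow> 'a \<Rightarrow> ('a \<Rightarrow> bool) set" where
  "char_dom S e = {\<phi> \<in> characters S. \<phi> e}"

definition char_act :: "('a, 'm) sgrp_scheme \<Rightarrow> 'a \<Rightarrow> ('a \<Rightarrow> bool) \<Rightarrow> 'a \<Rightarrow> bool" where
  "char_act S s \<phi> = (\<lambda>e\<in>idems S. \<phi> (star S s \<otimes>\<^bsub>S\<^esub> e \<otimes>\<^bsub>S\<^esub> s))"

definition germ_pairs :: "('a, 'm) sgrp_scheme \<Rightarrow> ('a \<times> ('a \<Rightarrow> bool)) set" where
  "germ_pairs S = {(s, \<phi>). s \<in> carrier S \<and> \<phi> \<in> char_dom S (star S s \<otimes>\<^bsub>S\<^esub> s)}"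

definition germ_rel ::
  "('a, 'm) sgrp_scheme \<Rightarrow> (('a \<times> ('a \<Rightarrow> bool)) \<times> ('a \<times> ('a \<Rightarrow> bool))) set" where
  "germ_rel S =
    {((s, \<phi>), (s', \<psi>)). (s, \<phi>) \<in> germ_pairs S \<and> (s', \<psi>) \<in> germ_pairs S \<and> \<phi> = \<psi> \<and>
      (\<exists>u\<in>carrier S. nat_le S u s \<and> nat_le S u s' \<and> \<phi> \<in> char_dom S (star S u \<otimes>\<^bsub>S\<^esub> u))}"

type_synonym 'a germ_class = "('a \<times> ('a \<Rightarrow> bool)) set"

definition germ :: "('a, 'm) sgrp_scheme \<Rightarrow> 'a \<Rightarrow> ('a \<Rightarrow> bool) \<Rightarrow> 'a germ_class" where
  "germ S s \<phi> = germ_rel S `` {(s, \<phi>)}"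

text \<open>The sets below form a base covering all germs, hence the generated topology
  consists exactly of their unions.\<close>

definition germ_topology :: "('a, 'm) sgrp_scheme \<Rightarrow> 'a germ_class topology" where
  "germ_topology S = topology_generated_by
    {germ S s ` U | s U. s \<in> carrier S \<and> openin (character_space S) U \<and>
      U \<subseteq> char_dom S (star S s \<otimes>\<^bsub>S\<^esub> s)}"

text \<open>The structure maps are defined on classes through representatives, on which the values do
  not depend. The identity at \<open>\<phi>\<close> is the class of \<open>(e, \<phi>)\<close> for any idempotent \<open>e\<close> with
  \<open>\<phi>(e) = 1\<close>.\<close>

definition universal_groupoid ::
  "('a, 'm) sgrp_scheme \<Rightarrow> ('a germ_class, 'a \<Rightarrow> bool) tgroupoid" where
  "universal_groupoid S =
    \<lparr> arrows = germ_topology S,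
      units = character_space S,
      gdom = (\<lambda>A. THE \<phi>. \<exists>s. (s, \<phi>) \<in> A),
      grng = (\<lambda>A. THE \<psi>. \<exists>s \<phi>. (s, \<phi>) \<in> A \<and> \<psi> = char_act S s \<phi>),
      gid = (\<lambda>\<phi>. THE A. \<exists>e\<in>idems S. \<phi> e \<and> A = germ S e \<phi>),
      gcomp = (\<lambda>A B. THE C. \<exists>s \<phi> s' \<psi>. (s, \<phi>) \<in> A \<and> (s', \<psi>) \<in> B \<and>
        \<phi> = char_act S s' \<psi> \<and> C = germ S (s \<otimes>\<^bsub>S\<^esub> s') \<psi>),
      ginv = (\<lambda>A. THE B. \<exists>s \<phi>. (s, \<phi>) \<in> A \<and> B = germ S (star S s) (char_act S s \<phi>)) \<rparr>"

end

theory Submission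
  imports Defs
begin

text \<open>
  An element \<open>x\<close> of the equivalence bimodule \<open>X\<close> acts on characters as a homeomorphism
  \<open>D([x, x]) \<rightarrow> D(\<langle>x, x\<rangle>)\<close>, \<open>(x\<phi>)(e) = \<phi>([x, e x])\<close>. Let \<open>Z\<close> be the disjoint union of the \<open>D([x, x])\<close>,
  with the maps \<open>(x, \<phi>) \<mapsto> x\<phi>\<close> and \<open>(x, \<phi>) \<mapsto> \<phi>\<close> to the two unit spaces; they are local homeomorphisms
  and surjective. An arrow from \<open>(x, \<phi>)\<close> to \<open>(x', \<phi>')\<close> in the pullback of \<open>\<G>(S)\<close> is the germ at \<open>x\<phi>\<close> of
  some \<open>s\<close>; the isomorphism sends it to the germ at \<open>\<phi>\<close> of \<open>[x', s x]\<close>, with inverse \<open>t \<mapsto> \<langle>x' t, x\<rangle>\<close>.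
  The construction is symmetric in \<open>S\<close> and \<open>T\<close>, so continuity is needed in one direction only.
\<close>

section \<open>Inverse semigroups\<close>

text \<open>The identities behind the construction hold in \<open>S\<close> and \<open>T\<close>
  only up to idempotents: going to \<open>T\<close> and back turns \<open>s\<close> into
  \<open>lprod x' x' \<otimes> s \<otimes> lprod x x\<close>, and composing two arrows over
  \<open>x'\<close> leaves a factor \<open>lprod x' x'\<close> in the middle. The characters
  involved take the value 1 at these factors, and a germ does not see multiplication by such an
  idempotent. Surjectivity onto the unit spaces rests on every idempotent of \<open>T\<close> being
  some \<open>rprod x x\<close>, and dually for \<open>S\<close>. The symmetry is given by
  \<open>star\<close>, which turns the right action of \<open>T\<close> into a left one. The
  remaining obstacle is the type of \<open>Z\<close>: the definition of Morita equivalence fixes it,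
  whereas \<open>X\<close> may live in any type. The isomorphism is therefore proved over an
  abstract space that carries a locally constant choice of \<open>x\<close> and the two unit maps,
  and a copy of the disjoint union in the prescribed type is supplied at the end.\<close>

context inverse_semigroup
begin

declare m_closed [simp]

lemma star_spec:
  assumes "s \<in> carrier S"
  shows "star S s \<in> carrier S \<and> s \<otimes> star S s \<otimes> s = s \<and> star S s \<otimes> s \<otimes> star S s = star S s"
  unfolding star_def by (rule theI') (rule ex1_star[OF assms])

lemma star_closed [simp]: "s \<in> carrier S \<Longrightarrow> star S s \<in> carrier S"
  using star_spec by blast

lemma star_eqI:
  assumes "s \<in> carrier S" "t \<in> carrier S" "s \<otimes> t \<otimes> s = s" "t \<otimes> s \<otimes> t = t"
  shows "star S s = t"
  using ex1_star[OF assms(1)] star_spec[OF assms(1)] assms by blast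

lemma mult_star_cancel [simp]:
  assumes "s \<in> carrier S"
  shows "s \<otimes> (star S s \<otimes> s) = s" "star S s \<otimes> (s \<otimes> star S s) = star S s"
  using star_spec[OF assms] assms by (simp_all add: m_assoc)

lemma mult_star_cancel_left [simp]:
  assumes "s \<in> carrier S" "x \<in> carrier S"
  shows "s \<otimes> (star S s \<otimes> (s \<otimes> x)) = s \<otimes> x"
    "star S s \<otimes> (s \<otimes> (star S s \<otimes> x)) = star S s \<otimes> x"
  using star_spec[OF assms(1)] assms by (simp_all flip: m_assoc)

lemma star_star [simp]: "s \<in> carrier S \<Longrightarrow> star S (star S s) = s"
  by (rule star_eqI) (simp_all add: m_assoc)

section \<open>Idempotents and their conjugates\<close>

lemma idemsI: "e \<in> carrier S \<Longrightarrow> e \<otimes> e = e \<Longrightarrow> e \<in> idems S"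
  by (simp add: idems_def)

lemma idem [simp]: "e \<in> idems S \<Longrightarrow> e \<otimes> e = e"
  and idems_carrier [simp]: "e \<in> idems S \<Longrightarrow> e \<in> carrier S"
  by (simp_all add: idems_def)

lemma idem_left [simp]: "e \<in> idems S \<Longrightarrow> x \<in> carrier S \<Longrightarrow> e \<otimes> (e \<otimes> x) = e \<otimes> x"
  by (simp flip: m_assoc)

lemma star_idem [simp]: "e \<in> idems S \<Longrightarrow> star S e = e"
  by (rule star_eqI) simp_all

text \<open>With \<open>x\<close> the inverse of \<open>e \<otimes> f\<close>, the element
  \<open>f \<otimes> x \<otimes> e\<close> is an inverse too, so uniqueness gives
  \<open>x = f \<otimes> x \<otimes> e\<close>. This makes \<open>x\<close> idempotent, hence equal
  to its own inverse \<open>e \<otimes> f\<close>.\<close>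

lemma idems_mult [simp]:
  assumes e: "e \<in> idems S" and f: "f \<in> idems S"
  shows "e \<otimes> f \<in> idems S"
proof -
  note [simp] = e f
  define x where "x = star S (e \<otimes> f)"
  have x [simp]: "x \<in> carrier S" by (simp add: x_def)
  have 1: "e \<otimes> (f \<otimes> (x \<otimes> (e \<otimes> f))) = e \<otimes> f"
    using star_spec[of "e \<otimes> f"] by (simp add: x_def flip: m_assoc)
  have 2: "x \<otimes> (e \<otimes> (f \<otimes> x)) = x"
    using star_spec[of "e \<otimes> f"] by (simp add: x_def flip: m_assoc)
  have 3: "x \<otimes> (e \<otimes> (f \<otimes> (x \<otimes> e))) = x \<otimes> e"
    using arg_cong[OF 2, of "\<lambda>u. u \<otimes> e"] by (simp add: m_assoc)
  have "star S (e \<otimes> f) = f \<otimes> x \<otimes> e"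
    by (rule star_eqI) (simp_all add: m_assoc 1 3)
  then have "x = f \<otimes> (x \<otimes> e)" by (simp add: m_assoc flip: x_def)
  then have "x \<otimes> x = f \<otimes> (x \<otimes> e) \<otimes> (f \<otimes> (x \<otimes> e))" by simp
  also have "\<dots> = f \<otimes> (x \<otimes> e)" by (simp add: m_assoc 3)
  finally have "x \<otimes> x = x" using \<open>x = f \<otimes> (x \<otimes> e)\<close> by simp
  then have "x \<in> idems S" by (rule idemsI[OF x])
  then have "star S x = x" by simp
  then have "e \<otimes> f = x" by (simp add: x_def)
  with \<open>x \<in> idems S\<close> show ?thesis by simp
qed

text \<open>Both products are idempotent, which makes \<open>f \<otimes> e\<close> an inverse of
  \<open>e \<otimes> f\<close>; but an idempotent is its own inverse.\<close>

lemma idems_commute: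
  assumes e: "e \<in> idems S" and f: "f \<in> idems S"
  shows "e \<otimes> f = f \<otimes> e"
proof -
  note [simp] = e f
  have *: "a \<otimes> (b \<otimes> (a \<otimes> b)) = a \<otimes> b" if "a \<in> idems S" "b \<in> idems S" for a b
  proof -
    have "a \<otimes> (b \<otimes> (a \<otimes> b)) = (a \<otimes> b) \<otimes> (a \<otimes> b)"
      using that by (simp add: m_assoc del: idem)
    then show ?thesis using that by simp
  qed
  have "star S (e \<otimes> f) = f \<otimes> e"
    by (rule star_eqI) (simp_all add: m_assoc *)
  then show ?thesis by simp
qed

lemma idems_left_commute:
  "e \<in> idems S \<Longrightarrow> f \<in> idems S \<Longrightarrow> x \<in> carrier S \<Longrightarrow> e \<otimes> (f \<otimes> x) = f \<otimes> (e \<otimes> x)"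
  by (metis idems_carrier idems_commute m_assoc)

lemma star_mult_idem [simp]: "s \<in> carrier S \<Longrightarrow> star S s \<otimes> s \<in> idems S"
  by (rule idemsI) (simp_all add: m_assoc)

lemma mult_star_idem [simp]: "s \<in> carrier S \<Longrightarrow> s \<otimes> star S s \<in> idems S"
  by (rule idemsI) (simp_all add: m_assoc)

text \<open>\<open>e\<close> commutes with the projections \<open>s \<otimes> star S s\<close> and
  \<open>star S s \<otimes> s\<close>. The right-nested form is the one that rewriting with
  \<open>m_assoc\<close> produces.\<close>

lemma idem_mult_star_cancel:
  assumes "s \<in> carrier S" "e \<in> idems S"
  shows "s \<otimes> (star S s \<otimes> (e \<otimes> s)) = e \<otimes> s" "star S s \<otimes> (s \<otimes> (e \<otimes> star S s)) = e \<otimes> star S s"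
proof -
  have "s \<otimes> star S s \<otimes> (e \<otimes> s) = e \<otimes> (s \<otimes> star S s \<otimes> s)"
    "star S s \<otimes> s \<otimes> (e \<otimes> star S s) = e \<otimes> (star S s \<otimes> s \<otimes> star S s)"
    using assms by (simp_all add: idems_left_commute)
  then show "s \<otimes> (star S s \<otimes> (e \<otimes> s)) = e \<otimes> s"
    "star S s \<otimes> (s \<otimes> (e \<otimes> star S s)) = e \<otimes> star S s"
    using assms by (simp_all add: m_assoc)
qed

lemma idem_mult_star_cancel_left:
  assumes "s \<in> carrier S" "e \<in> idems S" "x \<in> carrier S"
  shows "s \<otimes> (star S s \<otimes> (e \<otimes> (s \<otimes> x))) = e \<otimes> (s \<otimes> x)"
    "star S s \<otimes> (s \<otimes> (e \<otimes> (star S s \<otimes> x))) = e \<otimes> (star S s \<otimes> x)"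
  using arg_cong[OF idem_mult_star_cancel(1)[OF assms(1,2)], of "\<lambda>u. u \<otimes> x"]
    arg_cong[OF idem_mult_star_cancel(2)[OF assms(1,2)], of "\<lambda>u. u \<otimes> x"] assms
  by (simp_all add: m_assoc)

text \<open>In both defining equations the projections \<open>t \<otimes> star S t\<close> and
  \<open>star S s \<otimes> s\<close> meet in the middle; swapping them lets each cancel.\<close>

lemma star_mult:
  assumes s: "s \<in> carrier S" and t: "t \<in> carrier S"
  shows "star S (s \<otimes> t) = star S t \<otimes> star S s"
proof (rule star_eqI)
  note [simp] = s t
  have "(t \<otimes> star S t) \<otimes> ((star S s \<otimes> s) \<otimes> t) = (star S s \<otimes> s) \<otimes> (t \<otimes> star S t \<otimes> t)"
    using idems_left_commute[of "t \<otimes> star S t" "star S s \<otimes> s" t] by simp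
  then have "s \<otimes> (t \<otimes> (star S t \<otimes> (star S s \<otimes> (s \<otimes> t)))) = s \<otimes> (star S s \<otimes> (s \<otimes> t))"
    by (simp add: m_assoc)
  then show "s \<otimes> t \<otimes> (star S t \<otimes> star S s) \<otimes> (s \<otimes> t) = s \<otimes> t"
    by (simp add: m_assoc)
  have "(star S s \<otimes> s) \<otimes> ((t \<otimes> star S t) \<otimes> star S s) = (t \<otimes> star S t) \<otimes> (star S s \<otimes> s \<otimes> star S s)"
    using idems_left_commute[of "star S s \<otimes> s" "t \<otimes> star S t" "star S s"] by simp
  then have "star S t \<otimes> (star S s \<otimes> (s \<otimes> (t \<otimes> (star S t \<otimes> star S s)))) = star S t \<otimes> (t \<otimes> (star S t \<otimes> star S s))"
    by (simp add: m_assoc)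
  then show "star S t \<otimes> star S s \<otimes> (s \<otimes> t) \<otimes> (star S t \<otimes> star S s) = star S t \<otimes> star S s"
    by (simp add: m_assoc)
qed (use s t in simp_all)

lemma conj_idem [simp]:
  assumes "s \<in> carrier S" "e \<in> idems S"
  shows "star S s \<otimes> e \<otimes> s \<in> idems S" "s \<otimes> e \<otimes> star S s \<in> idems S"
  using assms by (auto intro!: idemsI simp: m_assoc idem_mult_star_cancel idem_mult_star_cancel_left)

text \<open>The factor \<open>s \<otimes> star S s\<close> between \<open>e\<close> and
  \<open>f\<close> on the right commutes out and is absorbed. Multiplicativity of the translated
  characters comes from here.\<close>

lemma conj_idem_mult:
  assumes "s \<in> carrier S" "e \<in> idems S" "f \<in> idems S"
  shows "star S s \<otimes> (e \<otimes> f) \<otimes> s = (star S s \<otimes> e \<otimes> s) \<otimes> (star S s \<otimes> f \<otimes> s)"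
  using assms by (simp add: m_assoc idem_mult_star_cancel)


section \<open>Characters and germs\<close>

lemma characterD:
  assumes "\<phi> \<in> characters S"
  shows "\<phi> \<in> idems S \<rightarrow>\<^sub>E UNIV" "\<exists>e\<in>idems S. \<phi> e"
    "e \<in> idems S \<Longrightarrow> f \<in> idems S \<Longrightarrow> \<phi> (e \<otimes> f) \<longleftrightarrow> \<phi> e \<and> \<phi> f"
  using assms by (auto simp: characters_def)

lemma character_eqI:
  assumes "\<phi> \<in> characters S" "\<psi> \<in> characters S" "\<And>e. e \<in> idems S \<Longrightarrow> \<phi> e = \<psi> e"
  shows "\<phi> = \<psi>"
  using PiE_ext[OF characterD(1)[OF assms(1)] characterD(1)[OF assms(2)] assms(3)] .

lemma char_act_apply [simp]:
  "e \<in> idems S \<Longrightarrow> char_act S s \<phi> e = \<phi> (star S s \<otimes> e \<otimes> s)"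
  by (simp add: char_act_def)

lemma char_act_characters:
  assumes s: "s \<in> carrier S" and \<phi>: "\<phi> \<in> char_dom S (star S s \<otimes> s)"
  shows "char_act S s \<phi> \<in> characters S"
proof -
  have \<phi>': "\<phi> \<in> characters S" "\<phi> (star S s \<otimes> s)"
    using \<phi> by (auto simp: char_dom_def)
  \<comment> \<open>Conjugation takes \<open>s \<otimes> star S s\<close> back to
    \<open>star S s \<otimes> s\<close>, where \<phi> is 1.\<close>
  have "\<exists>e\<in>idems S. char_act S s \<phi> e"
    using s \<phi>' by (intro bexI[of _ "s \<otimes> star S s"]) (simp_all add: m_assoc)
  moreover have "char_act S s \<phi> (e \<otimes> f) \<longleftrightarrow> char_act S s \<phi> e \<and> char_act S s \<phi> f"
    if "e \<in> idems S" "f \<in> idems S" for e f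
    using that s by (simp add: conj_idem_mult characterD(3)[OF \<phi>'(1)])
  ultimately show ?thesis
    by (auto simp: characters_def char_act_def)
qed

lemma char_act_char_dom:
  assumes s: "s \<in> carrier S" and \<phi>: "\<phi> \<in> char_dom S (star S s \<otimes> s)"
  shows "char_act S s \<phi> \<in> char_dom S (s \<otimes> star S s)"
  using char_act_characters[OF assms] assms by (simp add: char_dom_def m_assoc)

lemma char_act_mult:
  assumes "s \<in> carrier S" "t \<in> carrier S"
  shows "char_act S (s \<otimes> t) \<phi> = char_act S s (char_act S t \<phi>)"
  using assms by (auto simp: char_act_def star_mult m_assoc[symmetric] intro!: restrict_ext)

lemma char_act_idem:
  assumes "\<phi> \<in> characters S" "e \<in> idems S" "\<phi> e"
  shows "char_act S e \<phi> = \<phi>"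
proof (rule character_eqI)
  show "char_act S e \<phi> \<in> characters S"
    using assms by (intro char_act_characters) (auto simp: char_dom_def)
qed (use assms in \<open>auto simp: characterD(3)\<close>)

section \<open>Germs of semigroup elements at characters\<close>

lemma germ_pairsD:
  assumes "(s, \<phi>) \<in> germ_pairs S"
  shows "s \<in> carrier S" "\<phi> \<in> characters S" "\<phi> (star S s \<otimes> s)" "\<phi> \<in> char_dom S (star S s \<otimes> s)"
  using assms by (auto simp: germ_pairs_def char_dom_def)

lemma germ_pairsI:
  "s \<in> carrier S \<Longrightarrow> \<phi> \<in> characters S \<Longrightarrow> \<phi> (star S s \<otimes> s) \<Longrightarrow> (s, \<phi>) \<in> germ_pairs S"
  by (auto simp: germ_pairs_def char_dom_def)

text \<open>Trades the common lower bound \<open>u\<close> for an idempotent on the right: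
  \<open>e = star S u \<otimes> u\<close> in one direction, \<open>u = s \<otimes> e\<close> in the
  other. Witnesses of this form can be multiplied, since idempotents commute and \<phi> is
  multiplicative; the later lemmas on germs rest on it.\<close>

lemma germ_rel_iff:
  "((s, \<phi>), (r, \<psi>)) \<in> germ_rel S \<longleftrightarrow> (s, \<phi>) \<in> germ_pairs S \<and> (r, \<psi>) \<in> germ_pairs S \<and> \<phi> = \<psi> \<and>
    (\<exists>e\<in>idems S. \<phi> e \<and> s \<otimes> e = r \<otimes> e)" (is "?L \<longleftrightarrow> ?R")
proof
  assume ?L
  then obtain u where u: "u \<in> carrier S" "nat_le S u s" "nat_le S u r" "\<phi> (star S u \<otimes> u)"
    and p: "(s, \<phi>) \<in> germ_pairs S" "(r, \<psi>) \<in> germ_pairs S" "\<phi> = \<psi>"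
    by (auto simp: germ_rel_def char_dom_def)
  \<comment> \<open>An element \<open>u\<close> below \<open>t\<close> is \<open>t\<close> cut down
    to the domain of \<open>u\<close>.\<close>
  have "t \<otimes> (star S u \<otimes> u) = u" if t: "t \<in> carrier S" "nat_le S u t" for t
  proof -
    obtain e where e: "e \<in> idems S" "u = e \<otimes> t"
      using t(2) by (auto simp: nat_le_def)
    then show ?thesis
      using t(1) by (simp add: star_mult m_assoc idem_mult_star_cancel)
  qed
  then have "s \<otimes> (star S u \<otimes> u) = r \<otimes> (star S u \<otimes> u)"
    using u germ_pairsD[OF p(1)] germ_pairsD[OF p(2)] by simp
  with p u show ?R by (intro conjI bexI[of _ "star S u \<otimes> u"]) auto
next
  assume ?R
  then obtain e where e: "e \<in> idems S" "\<phi> e" "s \<otimes> e = r \<otimes> e"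
    and p: "(s, \<phi>) \<in> germ_pairs S" "(r, \<psi>) \<in> germ_pairs S" "\<phi> = \<psi>"
    by auto
  note s = germ_pairsD[OF p(1)] and r = germ_pairsD[OF p(2)]
  \<comment> \<open>\<open>nat_le\<close> has its idempotent on the left; conjugating
    \<open>e\<close> by \<open>t\<close> moves it there.\<close>
  have le: "nat_le S (t \<otimes> e) t" if t: "t \<in> carrier S" for t
  proof -
    have "t \<otimes> ((star S t \<otimes> t) \<otimes> e) = t \<otimes> (e \<otimes> (star S t \<otimes> t))"
      using t e by (simp add: idems_commute)
    then have "t \<otimes> e = (t \<otimes> e \<otimes> star S t) \<otimes> t"
      using t e by (simp add: m_assoc)
    then show ?thesis
      using t e conj_idem(2)[of t e] unfolding nat_le_def by blast
  qed
  have "star S (s \<otimes> e) \<otimes> (s \<otimes> e) = e \<otimes> ((star S s \<otimes> s) \<otimes> e)"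
    using s e(1) by (simp add: star_mult m_assoc)
  moreover have "\<phi> (e \<otimes> ((star S s \<otimes> s) \<otimes> e))"
    using s e(1,2) by (simp add: characterD(3))
  ultimately have "\<phi> \<in> char_dom S (star S (s \<otimes> e) \<otimes> (s \<otimes> e))"
    using s by (simp add: char_dom_def)
  then show ?L
    using p s e le[of s] le[of r] r by (auto simp: germ_rel_def intro!: bexI[of _ "s \<otimes> e"])
qed

lemma equiv_germ_rel: "equiv (germ_pairs S) (germ_rel S)"
proof (rule equivI)
  show "germ_rel S \<subseteq> germ_pairs S \<times> germ_pairs S"
    by (auto simp: germ_rel_def)
  show "refl_on (germ_pairs S) (germ_rel S)"
  proof (rule refl_onI)
    fix p assume p: "p \<in> germ_pairs S"
    obtain s \<phi> where "p = (s, \<phi>)" by force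
    with p germ_pairsD[of s \<phi>] characterD(2)[of \<phi>] show "(p, p) \<in> germ_rel S"
      by (auto simp: germ_rel_iff)
  qed
  show "sym (germ_rel S)"
    by (rule symI) (auto simp: germ_rel_iff; metis)
  show "trans (germ_rel S)"
  proof (rule transI)
    fix p q w assume pq: "(p, q) \<in> germ_rel S" and qw: "(q, w) \<in> germ_rel S"
    obtain s \<phi> r \<psi> t \<rho> where p: "p = (s, \<phi>)" and q: "q = (r, \<psi>)" and w: "w = (t, \<rho>)"
      by (metis surj_pair)
    from pq obtain e where e: "(s, \<phi>) \<in> germ_pairs S" "(r, \<phi>) \<in> germ_pairs S" "\<psi> = \<phi>"
      "e \<in> idems S" "\<phi> e" "s \<otimes> e = r \<otimes> e"
      unfolding p q germ_rel_iff by blast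
    from qw obtain f where f: "(t, \<phi>) \<in> germ_pairs S" "\<rho> = \<phi>"
      "f \<in> idems S" "\<phi> f" "r \<otimes> f = t \<otimes> f"
      unfolding q w germ_rel_iff e(3) by blast
    have c: "s \<in> carrier S" "r \<in> carrier S" "t \<in> carrier S" "e \<in> carrier S" "f \<in> carrier S"
      using e(1,2,4) f(1,3) germ_pairsD(1) by auto
    \<comment> \<open>The product of the two witnesses is a witness for \<open>s\<close> and
      \<open>t\<close>.\<close>
    have "s \<otimes> (e \<otimes> f) = r \<otimes> (e \<otimes> f)"
      using e(6) m_assoc[of s e f] m_assoc[of r e f] c by simp
    also have "\<dots> = r \<otimes> (f \<otimes> e)" using e(4) f(3) by (simp add: idems_commute)
    also have "\<dots> = t \<otimes> (f \<otimes> e)"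
      using f(5) m_assoc[of r f e] m_assoc[of t f e] c by simp
    also have "\<dots> = t \<otimes> (e \<otimes> f)" using e(4) f(3) by (simp add: idems_commute)
    finally have "s \<otimes> (e \<otimes> f) = t \<otimes> (e \<otimes> f)" .
    moreover have "\<phi> (e \<otimes> f)"
      using e(4,5) f(3,4) germ_pairsD(2)[OF e(1)] by (simp add: characterD(3))
    ultimately show "(p, w) \<in> germ_rel S"
      unfolding p w germ_rel_iff f(2) using e(1,4) f(1,3) idems_mult by blast
  qed
qed

lemma mem_germ_iff:
  "(r, \<psi>) \<in> germ S s \<phi> \<longleftrightarrow> (s, \<phi>) \<in> germ_pairs S \<and> (r, \<psi>) \<in> germ_pairs S \<and> \<psi> = \<phi> \<and>
    (\<exists>e\<in>idems S. \<phi> e \<and> s \<otimes> e = r \<otimes> e)"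
  unfolding germ_def by (auto simp: germ_rel_iff)

lemma germ_self: "(s, \<phi>) \<in> germ_pairs S \<Longrightarrow> (s, \<phi>) \<in> germ S s \<phi>"
  unfolding germ_def using equiv_germ_rel by (rule equiv_class_self)

lemma germ_eqI:
  assumes "(s, \<phi>) \<in> germ_pairs S" "(r, \<phi>) \<in> germ_pairs S"
    "e \<in> idems S" "\<phi> e" "s \<otimes> e = r \<otimes> e"
  shows "germ S s \<phi> = germ S r \<phi>"
  unfolding germ_def using assms
  by (intro equiv_class_eq[OF equiv_germ_rel]) (auto simp: germ_rel_iff)

lemma germ_eq_if_mem:
  assumes "(r, \<psi>) \<in> germ S s \<phi>"
  shows "germ S r \<psi> = germ S s \<phi>"
proof -
  obtain e where "(s, \<phi>) \<in> germ_pairs S" "(r, \<phi>) \<in> germ_pairs S" "\<psi> = \<phi>"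
    "e \<in> idems S" "\<phi> e" "s \<otimes> e = r \<otimes> e"
    using assms by (auto simp: mem_germ_iff)
  then show ?thesis using germ_eqI[of s \<phi> r e] by simp
qed

lemma germ_eq_iff:
  assumes "(s, \<phi>) \<in> germ_pairs S" "(r, \<psi>) \<in> germ_pairs S"
  shows "germ S s \<phi> = germ S r \<psi> \<longleftrightarrow> \<phi> = \<psi> \<and> (\<exists>e\<in>idems S. \<phi> e \<and> s \<otimes> e = r \<otimes> e)"
  using assms germ_self[OF assms(2)] germ_eqI[of s \<phi> r] mem_germ_iff[of r \<psi> s \<phi>] by metis

end


section \<open>Topology of the universal groupoid\<close>

text \<open>Meant for maps defined by description or choice, for which an explicit formula
  \<open>g\<close> is available only near each point. The pasted pieces are all \<open>f\<close>
  itself, indexed by the open sets on which it is continuous.\<close>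

lemma continuous_map_locallyI:
  assumes "\<And>x. x \<in> topspace X \<Longrightarrow> \<exists>U g. openin X U \<and> x \<in> U \<and>
    continuous_map (subtopology X U) Y g \<and> (\<forall>y\<in>U. f y = g y)"
  shows "continuous_map X Y f"
proof (rule pasting_lemma[where T = "\<lambda>U. U" and f = "\<lambda>_. f"])
  fix x assume "x \<in> topspace X"
  then obtain U g where U: "openin X U" "x \<in> U" "continuous_map (subtopology X U) Y g" "\<forall>y\<in>U. f y = g y"
    using assms by blast
  then have "continuous_map (subtopology X U) Y f"
    by (auto intro: continuous_map_eq)
  with U show "\<exists>U. U \<in> {U. openin X U \<and> continuous_map (subtopology X U) Y f} \<and> x \<in> U \<and> f x = f x"
    by blast
qed auto

context inverse_semigroup
begin

section \<open>The space of characters\<close>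

lemma topspace_character_space [simp]: "topspace (character_space S) = characters S"
  by (auto simp: character_space_def characters_def)

lemma continuous_map_char_eval:
  assumes "e \<in> idems S"
  shows "continuous_map (character_space S) (discrete_topology UNIV) (\<lambda>\<phi>. \<phi> e)"
  unfolding character_space_def
  using continuous_map_from_subtopology[OF continuous_map_product_coordinates[OF assms]] .

lemma continuous_map_into_character_space:
  assumes "\<And>z. z \<in> topspace Z \<Longrightarrow> g z \<in> characters S"
    and "\<And>e. e \<in> idems S \<Longrightarrow> continuous_map Z (discrete_topology UNIV) (\<lambda>z. g z e)"
  shows "continuous_map Z (character_space S) g"
  unfolding character_space_def
proof (rule continuous_map_into_subtopology)
  show "continuous_map Z (product_topology (\<lambda>_. discrete_topology UNIV) (idems S)) g"
    using assms characterD(1) by (intro continuous_map_coordinatewise_then_product) auto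
qed (use assms in auto)

lemma openin_char_dom [simp]:
  assumes "e \<in> idems S"
  shows "openin (character_space S) (char_dom S e)"
  using openin_continuous_map_preimage[OF continuous_map_char_eval[OF assms], of "{True}"]
  by (simp add: char_dom_def)

lemma characters_Int_char_dom [simp]: "characters S \<inter> char_dom S e = char_dom S e"
  by (auto simp: char_dom_def)

text \<open>In the compact product, multiplicativity is a closed condition and being non-zero an
  open one, so the characters form an open subset of a closed subset.\<close>

lemma lc_hausdorff_character_space: "lc_hausdorff (character_space S)"
proof -
  let ?P = "product_topology (\<lambda>_. discrete_topology (UNIV :: bool set)) (idems S)"
  have H: "Hausdorff_space ?P"
    by (simp add: Hausdorff_space_product_topology)
  have "compact_space ?P"
    by (simp add: compact_space_product_topology compact_space_discrete_topology)
  then have lc: "locally_compact_space ?P"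
    by (rule compact_imp_locally_compact_space)
  define C where "C e f = {\<phi> \<in> topspace ?P. (\<phi> (e \<otimes> f), \<phi> e, \<phi> f) \<in> {(a, b, c). a = (b \<and> c)}}" for e f
  have clC: "closedin ?P (C e f)" if "e \<in> idems S" "f \<in> idems S" for e f
  proof -
    have "continuous_map ?P (prod_topology (discrete_topology UNIV)
        (prod_topology (discrete_topology UNIV) (discrete_topology UNIV)))
        (\<lambda>\<phi>. (\<phi> (e \<otimes> f), \<phi> e, \<phi> f))"
      using that by (intro continuous_map_pairedI continuous_map_product_coordinates) auto
    then show ?thesis
      unfolding C_def
      by (rule closedin_continuous_map_preimage) (simp add: prod_topology_discrete_topology[symmetric])
  qed
  \<comment> \<open>The whole space joins the family to keep it non-empty even when there are no
    idempotents.\<close>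
  define K where "K = \<Inter>(insert (topspace ?P) ((\<lambda>(e, f). C e f) ` (idems S \<times> idems S)))"
  have clK: "closedin ?P K"
    unfolding K_def
  proof (rule closedin_Inter)
    show "closedin ?P A" if "A \<in> insert (topspace ?P) ((\<lambda>(e, f). C e f) ` (idems S \<times> idems S))" for A
      using that
    proof (rule insertE)
      assume "A = topspace ?P"
      then show ?thesis by (simp only: closedin_topspace)
    qed (auto intro: clC)
  qed simp
  have lcK: "locally_compact_space (subtopology ?P K)"
    by (rule locally_compact_space_closed_subset[OF lc clK])
  have HK: "Hausdorff_space (subtopology ?P K)"
    by (rule Hausdorff_space_subtopology[OF H])
  define W where "W = (\<Union>e\<in>idems S. {\<phi> \<in> topspace ?P. \<phi> e \<in> {True}})"
  have "openin ?P W"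
    unfolding W_def
  proof (rule openin_Union)
    fix A assume "A \<in> (\<lambda>e. {\<phi> \<in> topspace ?P. \<phi> e \<in> {True}}) ` idems S"
    then obtain e where e: "e \<in> idems S" "A = {\<phi> \<in> topspace ?P. \<phi> e \<in> {True}}" by blast
    show "openin ?P A"
      unfolding e(2)
      by (rule openin_continuous_map_preimage[OF continuous_map_product_coordinates[OF e(1)]]) simp
  qed
  then have "openin (subtopology ?P K) (K \<inter> W)"
    by (simp add: openin_subtopology_Int2)
  moreover have "characters S = K \<inter> W"
    by (auto simp: characters_def K_def W_def C_def)
  ultimately have "locally_compact_space (subtopology (subtopology ?P K) (characters S))"
    using locally_compact_space_open_subset HK lcK by metis
  moreover have "subtopology (subtopology ?P K) (characters S) = character_space S"
    using \<open>characters S = K \<inter> W\<close> by (simp add: character_space_def subtopology_subtopology)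
  ultimately show ?thesis
    using Hausdorff_space_subtopology[OF H, of "characters S"]
    by (simp add: lc_hausdorff_def character_space_def)
qed

lemma continuous_map_char_act:
  assumes "s \<in> carrier S"
  shows "continuous_map (subtopology (character_space S) (char_dom S (star S s \<otimes> s)))
    (character_space S) (char_act S s)"
proof (rule continuous_map_into_character_space)
  fix e assume "e \<in> idems S"
  then show "continuous_map (subtopology (character_space S) (char_dom S (star S s \<otimes> s)))
      (discrete_topology UNIV) (\<lambda>\<phi>. char_act S s \<phi> e)"
    using assms by (auto intro!: continuous_map_from_subtopology continuous_map_char_eval)
qed (use char_act_characters[OF assms] in auto)

section \<open>The topology on germs\<close>

lemma openin_germ_image:
  assumes "s \<in> carrier S" "openin (character_space S) U" "U \<subseteq> char_dom S (star S s \<otimes> s)"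
  shows "openin (germ_topology S) (germ S s ` U)"
  unfolding germ_topology_def using assms by (intro topology_generated_by_Basis) blast

lemma topspace_germ_topology:
  "topspace (germ_topology S) = (\<lambda>(s, \<phi>). germ S s \<phi>) ` germ_pairs S"
proof
  show "topspace (germ_topology S) \<subseteq> (\<lambda>(s, \<phi>). germ S s \<phi>) ` germ_pairs S"
    unfolding germ_topology_def topology_generated_by_topspace by (auto simp: germ_pairs_def)
  show "(\<lambda>(s, \<phi>). germ S s \<phi>) ` germ_pairs S \<subseteq> topspace (germ_topology S)"
  proof clarify
    fix s \<phi> assume "(s, \<phi>) \<in> germ_pairs S"
    then have "openin (germ_topology S) (germ S s ` char_dom S (star S s \<otimes> s))"
      "germ S s \<phi> \<in> germ S s ` char_dom S (star S s \<otimes> s)"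
      by (auto simp: germ_pairs_def intro!: openin_germ_image)
    then show "germ S s \<phi> \<in> topspace (germ_topology S)"
      using openin_subset by blast
  qed
qed

lemma germ_cases:
  assumes "A \<in> topspace (germ_topology S)"
  obtains s \<phi> where "(s, \<phi>) \<in> germ_pairs S" "A = germ S s \<phi>"
  using assms by (auto simp: topspace_germ_topology)

lemma germ_in_topspace: "(s, \<phi>) \<in> germ_pairs S \<Longrightarrow> germ S s \<phi> \<in> topspace (germ_topology S)"
  by (auto simp: topspace_germ_topology)

text \<open>The topology is given by generators, so this is an induction on how \<open>W\<close> is
  generated. For a generator the question is where the sections \<open>germ S s\<close> and
  \<open>germ S r\<close> meet. That is an open condition: if \<open>e\<close> witnesses equality at
  \<phi>, it does so throughout the part of \<open>char_dom S e\<close> where both germs are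
  defined.\<close>

lemma openin_germ_topology_preimage:
  assumes W: "openin (germ_topology S) W" and s: "s \<in> carrier S"
  shows "openin (character_space S) {\<phi> \<in> char_dom S (star S s \<otimes> s). germ S s \<phi> \<in> W}"
proof -
  have "generate_topology_on {germ S s ` U | s U. s \<in> carrier S \<and> openin (character_space S) U \<and>
      U \<subseteq> char_dom S (star S s \<otimes> s)} W"
    using W by (simp add: germ_topology_def openin_topology_generated_by_iff)
  then show ?thesis
  proof induction
    case Empty
    then show ?case by simp
  next
    case (Int a b)
    have "{\<phi> \<in> char_dom S (star S s \<otimes> s). germ S s \<phi> \<in> a \<inter> b} =
      {\<phi> \<in> char_dom S (star S s \<otimes> s). germ S s \<phi> \<in> a} \<inter> {\<phi> \<in> char_dom S (star S s \<otimes> s). germ S s \<phi> \<in> b}"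
      by blast
    with Int.IH show ?case by (simp add: openin_Int)
  next
    case (UN K)
    have "{\<phi> \<in> char_dom S (star S s \<otimes> s). germ S s \<phi> \<in> \<Union>K} =
      (\<Union>k\<in>K. {\<phi> \<in> char_dom S (star S s \<otimes> s). germ S s \<phi> \<in> k})"
      by blast
    with UN.IH show ?case by auto
  next
    case (Basis B)
    then obtain r U where r: "r \<in> carrier S" and U: "openin (character_space S) U"
      "U \<subseteq> char_dom S (star S r \<otimes> r)" and B: "B = germ S r ` U"
      by blast
    have "{\<phi> \<in> char_dom S (star S s \<otimes> s). germ S s \<phi> \<in> B} =
      U \<inter> char_dom S (star S s \<otimes> s) \<inter> (\<Union>e\<in>{e \<in> idems S. s \<otimes> e = r \<otimes> e}. char_dom S e)" (is "?L = ?R")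
    proof (rule Set.set_eqI)
      fix \<phi>
      show "\<phi> \<in> ?L \<longleftrightarrow> \<phi> \<in> ?R"
      proof (cases "\<phi> \<in> char_dom S (star S s \<otimes> s)")
        case True
        then have p: "(s, \<phi>) \<in> germ_pairs S" using s by (simp add: germ_pairs_def)
        have "germ S s \<phi> \<in> B \<longleftrightarrow> (\<exists>\<psi>\<in>U. germ S s \<phi> = germ S r \<psi>)" using B by blast
        also have "\<dots> \<longleftrightarrow> (\<exists>\<psi>\<in>U. \<phi> = \<psi> \<and> (\<exists>e\<in>idems S. \<phi> e \<and> s \<otimes> e = r \<otimes> e))"
        proof (intro bex_cong refl)
          fix \<psi> assume "\<psi> \<in> U"
          then have "(r, \<psi>) \<in> germ_pairs S" using U r by (auto simp: germ_pairs_def)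
          then show "germ S s \<phi> = germ S r \<psi> \<longleftrightarrow> \<phi> = \<psi> \<and> (\<exists>e\<in>idems S. \<phi> e \<and> s \<otimes> e = r \<otimes> e)"
            by (rule germ_eq_iff[OF p])
        qed
        finally show ?thesis using True germ_pairsD(2)[OF p] by (auto simp: char_dom_def)
      qed auto
    qed
    moreover have "openin (character_space S) ?R"
      using U(1) s by (intro openin_Int openin_Union) auto
    ultimately show ?case by simp
  qed
qed

lemma continuous_map_germ:
  assumes s: "s \<in> carrier S"
  shows "continuous_map (subtopology (character_space S) (char_dom S (star S s \<otimes> s)))
    (germ_topology S) (germ S s)"
  unfolding continuous_map_def
proof (intro conjI allI impI)
  show "germ S s \<in> topspace (subtopology (character_space S) (char_dom S (star S s \<otimes> s))) \<rightarrow>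
      topspace (germ_topology S)"
    using s by (auto simp: topspace_germ_topology germ_pairs_def)
  fix W assume "openin (germ_topology S) W"
  then have "openin (character_space S) {\<phi> \<in> char_dom S (star S s \<otimes> s). germ S s \<phi> \<in> W}"
    using s by (rule openin_germ_topology_preimage)
  then show "openin (subtopology (character_space S) (char_dom S (star S s \<otimes> s)))
      {\<phi> \<in> topspace (subtopology (character_space S) (char_dom S (star S s \<otimes> s))). germ S s \<phi> \<in> W}"
    using s by (simp add: openin_open_subtopology)
qed

text \<open>The preimage of an open set is a union of images of open sets under the sections
  \<open>germ S s\<close>. Continuity on germs thus reduces to continuity on characters, one
  \<open>s\<close> at a time.\<close>

lemma continuous_map_from_germ_topology:
  assumes cont: "\<And>s. s \<in> carrier S \<Longrightarrow> continuous_map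
    (subtopology (character_space S) (char_dom S (star S s \<otimes> s))) Y (\<lambda>\<phi>. f (germ S s \<phi>))"
  shows "continuous_map (germ_topology S) Y f"
  unfolding continuous_map_def
proof (intro conjI allI impI)
  show "f \<in> topspace (germ_topology S) \<rightarrow> topspace Y"
    using continuous_map_funspace[OF cont]
    by (fastforce simp: topspace_germ_topology germ_pairs_def char_dom_def)
  fix V assume V: "openin Y V"
  define U where "U s = {\<phi> \<in> char_dom S (star S s \<otimes> s). f (germ S s \<phi>) \<in> V}" for s
  have U: "openin (character_space S) (U s)" if "s \<in> carrier S" for s
    using openin_continuous_map_preimage[OF cont[OF that] V] that
    by (simp add: openin_open_subtopology U_def)
  have "{A \<in> topspace (germ_topology S). f A \<in> V} = (\<Union>s\<in>carrier S. germ S s ` U s)"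
    by (auto simp: topspace_germ_topology germ_pairs_def U_def)
  moreover have "openin (germ_topology S) (germ S s ` U s)" if "s \<in> carrier S" for s
    using that U by (intro openin_germ_image) (auto simp: U_def)
  ultimately show "openin (germ_topology S) {A \<in> topspace (germ_topology S). f A \<in> V}"
    by (auto intro!: openin_Union)
qed

section \<open>Structure maps computed on representatives\<close>

lemma universal_groupoid_simps [simp]:
  "arrows (universal_groupoid S) = germ_topology S"
  "units (universal_groupoid S) = character_space S"
  by (simp_all add: universal_groupoid_def)

lemma gdom_germ [simp]:
  assumes "(s, \<phi>) \<in> germ_pairs S"
  shows "gdom (universal_groupoid S) (germ S s \<phi>) = \<phi>"
  using germ_self[OF assms] by (auto simp: universal_groupoid_def mem_germ_iff intro!: the_equality)

text \<open>A witness \<open>e\<close> for the equality of germs fixes \<phi>, so both elements act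
  on \<phi> as \<open>s \<otimes> e = r \<otimes> e\<close> does.\<close>

lemma char_act_germ:
  assumes "(r, \<psi>) \<in> germ S s \<phi>"
  shows "char_act S r \<psi> = char_act S s \<phi>"
proof -
  obtain e where p: "(s, \<phi>) \<in> germ_pairs S" "(r, \<phi>) \<in> germ_pairs S" "\<psi> = \<phi>"
    and e: "e \<in> idems S" "\<phi> e" "s \<otimes> e = r \<otimes> e"
    using assms by (auto simp: mem_germ_iff)
  note s = germ_pairsD[OF p(1)] and r = germ_pairsD[OF p(2)]
  have \<phi>: "char_act S e \<phi> = \<phi>" using s e(1,2) by (simp add: char_act_idem)
  have "char_act S r (char_act S e \<phi>) = char_act S s (char_act S e \<phi>)"
    using e(3) s(1) r(1) e(1) by (simp flip: char_act_mult)
  with \<phi> p show ?thesis by simp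
qed

lemma grng_germ [simp]:
  assumes "(s, \<phi>) \<in> germ_pairs S"
  shows "grng (universal_groupoid S) (germ S s \<phi>) = char_act S s \<phi>"
proof -
  have "(THE x. \<exists>r \<psi>. (r, \<psi>) \<in> germ S s \<phi> \<and> x = char_act S r \<psi>) = char_act S s \<phi>"
  proof (rule the_equality)
    show "\<exists>r \<psi>. (r, \<psi>) \<in> germ S s \<phi> \<and> char_act S s \<phi> = char_act S r \<psi>"
      using germ_self[OF assms] by blast
  qed (auto dest: char_act_germ)
  then show ?thesis by (simp add: universal_groupoid_def)
qed

lemma germ_pairs_idem:
  "e \<in> idems S \<Longrightarrow> \<phi> \<in> characters S \<Longrightarrow> \<phi> e \<Longrightarrow> (e, \<phi>) \<in> germ_pairs S"
  by (rule germ_pairsI) auto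

lemma germ_idem_eq:
  assumes "e \<in> idems S" "f \<in> idems S" "\<phi> \<in> characters S" "\<phi> e" "\<phi> f"
  shows "germ S e \<phi> = germ S f \<phi>"
  using assms by (intro germ_eqI[of _ _ _ "e \<otimes> f"] germ_pairs_idem)
    (auto simp: characterD(3) idems_left_commute[of f e])

lemma gid_eq_germ:
  assumes "e \<in> idems S" "\<phi> \<in> characters S" "\<phi> e"
  shows "gid (universal_groupoid S) \<phi> = germ S e \<phi>"
proof -
  have "(THE A. \<exists>e\<in>idems S. \<phi> e \<and> A = germ S e \<phi>) = germ S e \<phi>"
    using assms germ_idem_eq[of _ e \<phi>] by (intro the_equality) blast+
  then show ?thesis by (simp add: universal_groupoid_def)
qed

lemma germ_pairs_mult:
  assumes "(s, char_act S t \<psi>) \<in> germ_pairs S" "(t, \<psi>) \<in> germ_pairs S"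
  shows "(s \<otimes> t, \<psi>) \<in> germ_pairs S"
  using germ_pairsD[OF assms(1)] germ_pairsD[OF assms(2)]
  by (intro germ_pairsI) (auto simp: star_mult m_assoc)

lemma germ_mult_idem:
  assumes p: "(s, \<phi>) \<in> germ_pairs S" and e: "e \<in> idems S" "\<phi> e"
  shows "(s \<otimes> e, \<phi>) \<in> germ S s \<phi>"
proof -
  note s = germ_pairsD[OF p]
  have "(s, char_act S e \<phi>) \<in> germ_pairs S"
    using p s e by (simp add: char_act_idem)
  then have "(s \<otimes> e, \<phi>) \<in> germ_pairs S"
    using s e by (intro germ_pairs_mult[OF _ germ_pairs_idem])
  moreover have "s \<otimes> e = s \<otimes> e \<otimes> e"
    using s e by (simp add: m_assoc)
  ultimately show ?thesis
    unfolding mem_germ_iff using p e by blast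
qed

text \<open>Moved through \<open>s\<close> to the right, \<open>g\<close> becomes
  \<open>star S s \<otimes> g \<otimes> s\<close>; that \<rho> is 1 there is exactly the hypothesis
  on \<open>char_act S s \<rho>\<close>.\<close>

lemma germ_insert_idem:
  assumes p: "(s, \<rho>) \<in> germ_pairs S" and g: "g \<in> idems S" "char_act S s \<rho> g"
    and h: "h \<in> idems S" "\<rho> h"
  shows "(g \<otimes> s \<otimes> h, \<rho>) \<in> germ S s \<rho>"
proof -
  note s = germ_pairsD[OF p]
  let ?k = "star S s \<otimes> g \<otimes> s"
  have k: "?k \<in> idems S" "\<rho> ?k" using g s by simp_all
  have sk: "s \<otimes> ?k = g \<otimes> s"
    using s g by (simp add: m_assoc idem_mult_star_cancel)
  have *: "s \<otimes> (?k \<otimes> h) = g \<otimes> s \<otimes> h"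
    using sk s(1) k(1) h(1) by (metis m_assoc idems_carrier)
  have hk: "?k \<otimes> h \<in> idems S" "\<rho> (?k \<otimes> h)"
    using k h s by (simp_all add: characterD(3))
  then have "(s \<otimes> (?k \<otimes> h), \<rho>) \<in> germ S s \<rho>"
    using p by (intro germ_mult_idem)
  then show ?thesis by (simp only: *)
qed

lemma germ_mult_cong:
  assumes A: "(s', char_act S t \<psi>) \<in> germ S s (char_act S t \<psi>)" and B: "(t', \<psi>) \<in> germ S t \<psi>"
  shows "germ S (s' \<otimes> t') \<psi> = germ S (s \<otimes> t) \<psi>"
proof -
  let ?\<phi> = "char_act S t \<psi>"
  obtain e where p: "(s, ?\<phi>) \<in> germ_pairs S" "(s', ?\<phi>) \<in> germ_pairs S"
    and e: "e \<in> idems S" "?\<phi> e" "s \<otimes> e = s' \<otimes> e"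
    using A unfolding mem_germ_iff by blast
  obtain f where q: "(t, \<psi>) \<in> germ_pairs S" "(t', \<psi>) \<in> germ_pairs S"
    and f: "f \<in> idems S" "\<psi> f" "t \<otimes> f = t' \<otimes> f"
    using B unfolding mem_germ_iff by blast
  note c = germ_pairsD(1)[OF p(1)] germ_pairsD(1)[OF p(2)] germ_pairsD(1)[OF q(1)] germ_pairsD(1)[OF q(2)]
  \<comment> \<open>The witness \<open>e\<close> sits between the two factors. Pulled back through
    \<open>t\<close> it becomes \<open>g\<close>, which stands to the right of \<open>t\<close> and
    can be combined with \<open>f\<close>.\<close>
  define g where "g = star S t \<otimes> e \<otimes> t"
  have g: "g \<in> idems S" "\<psi> g"
    using e(1,2) c by (simp_all add: g_def)
  have tg: "t \<otimes> (g \<otimes> f) = e \<otimes> (t \<otimes> f)"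
    using e(1) f(1) c by (simp add: g_def m_assoc idem_mult_star_cancel_left)
  have "s \<otimes> t \<otimes> (g \<otimes> f) = s \<otimes> e \<otimes> (t \<otimes> f)"
    using tg e(1) f(1) c g(1) by (simp add: m_assoc)
  also have "\<dots> = s' \<otimes> (t \<otimes> (g \<otimes> f))"
    using tg e f(1) c g(1) by (simp add: m_assoc)
  also have "\<dots> = s' \<otimes> (t \<otimes> f \<otimes> g)"
    using f(1) c g(1) by (simp add: idems_commute[of g f] m_assoc)
  also have "\<dots> = s' \<otimes> (t' \<otimes> f \<otimes> g)" by (simp add: f(3))
  also have "\<dots> = s' \<otimes> t' \<otimes> (g \<otimes> f)"
    using f(1) c g(1) by (simp add: idems_commute[of g f] m_assoc)
  finally have *: "s \<otimes> t \<otimes> (g \<otimes> f) = s' \<otimes> t' \<otimes> (g \<otimes> f)" .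
  have "char_act S t' \<psi> = ?\<phi>" by (rule char_act_germ[OF B])
  then have "(s' \<otimes> t', \<psi>) \<in> germ_pairs S"
    using germ_pairs_mult[of s' t' \<psi>] p q by simp
  moreover have "(s \<otimes> t, \<psi>) \<in> germ_pairs S"
    using germ_pairs_mult[of s t \<psi>] p q by simp
  moreover have "\<psi> (g \<otimes> f)"
    using g f(1,2) germ_pairsD(2)[OF q(1)] by (simp add: characterD(3))
  ultimately show ?thesis
    using * g f(1) by (metis germ_eqI idems_mult)
qed

lemma gcomp_germ [simp]:
  assumes "(s, char_act S t \<psi>) \<in> germ_pairs S" "(t, \<psi>) \<in> germ_pairs S"
  shows "gcomp (universal_groupoid S) (germ S s (char_act S t \<psi>)) (germ S t \<psi>) = germ S (s \<otimes> t) \<psi>"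
proof -
  have "(THE C. \<exists>s' \<phi> t' \<psi>'. (s', \<phi>) \<in> germ S s (char_act S t \<psi>) \<and> (t', \<psi>') \<in> germ S t \<psi> \<and>
      \<phi> = char_act S t' \<psi>' \<and> C = germ S (s' \<otimes> t') \<psi>') = germ S (s \<otimes> t) \<psi>"
  proof (rule the_equality)
    show "\<exists>s' \<phi> t' \<psi>'. (s', \<phi>) \<in> germ S s (char_act S t \<psi>) \<and> (t', \<psi>') \<in> germ S t \<psi> \<and>
      \<phi> = char_act S t' \<psi>' \<and> germ S (s \<otimes> t) \<psi> = germ S (s' \<otimes> t') \<psi>'"
      using germ_self[OF assms(1)] germ_self[OF assms(2)] by blast
  next
    fix C assume "\<exists>s' \<phi> t' \<psi>'. (s', \<phi>) \<in> germ S s (char_act S t \<psi>) \<and> (t', \<psi>') \<in> germ S t \<psi> \<and>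
      \<phi> = char_act S t' \<psi>' \<and> C = germ S (s' \<otimes> t') \<psi>'"
    then obtain s' \<phi> t' \<psi>' where *: "(s', \<phi>) \<in> germ S s (char_act S t \<psi>)" "(t', \<psi>') \<in> germ S t \<psi>"
      "C = germ S (s' \<otimes> t') \<psi>'"
      by blast
    then have "\<phi> = char_act S t \<psi>" "\<psi>' = \<psi>" by (simp_all add: mem_germ_iff)
    with * germ_mult_cong[of s' t \<psi> s t'] show "C = germ S (s \<otimes> t) \<psi>" by simp
  qed
  then show ?thesis by (simp add: universal_groupoid_def)
qed

lemma germ_pairs_star:
  assumes "(s, \<phi>) \<in> germ_pairs S"
  shows "(star S s, char_act S s \<phi>) \<in> germ_pairs S"
  using germ_pairsD(1)[OF assms] char_act_char_dom[OF germ_pairsD(1,4)[OF assms]]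
  by (simp add: germ_pairs_def)

text \<open>The witness moves from the domain to the range. Both
  \<open>s \<otimes> e \<otimes> star S s\<close> and its product with \<open>star S s\<close> on
  the left can be expressed through \<open>s \<otimes> e\<close> alone, so they agree with the same
  expressions for \<open>r\<close>.\<close>

lemma germ_star_cong:
  assumes "(r, \<psi>) \<in> germ S s \<phi>"
  shows "germ S (star S r) (char_act S r \<psi>) = germ S (star S s) (char_act S s \<phi>)"
proof -
  obtain e where p: "(s, \<phi>) \<in> germ_pairs S" "(r, \<phi>) \<in> germ_pairs S" "\<psi> = \<phi>"
    and e: "e \<in> idems S" "\<phi> e" "s \<otimes> e = r \<otimes> e"
    using assms by (auto simp: mem_germ_iff)
  note s = germ_pairsD[OF p(1)] and r = germ_pairsD[OF p(2)]
  have f: "star S t \<otimes> (t \<otimes> e \<otimes> star S t) = star S (t \<otimes> e)"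
    "t \<otimes> e \<otimes> star S t = (t \<otimes> e) \<otimes> star S (t \<otimes> e)" if "t \<in> carrier S" for t
    using that e(1) by (simp_all add: star_mult m_assoc idem_mult_star_cancel)
  let ?f = "s \<otimes> e \<otimes> star S s"
  have "star S s \<otimes> ?f = star S r \<otimes> ?f"
    using f[OF s(1)] f[OF r(1)] e(3) by simp
  moreover have "char_act S s \<phi> ?f"
  proof -
    have "star S s \<otimes> ?f \<otimes> s = e \<otimes> (star S s \<otimes> s)"
      using s(1) e(1) by (simp add: m_assoc idem_mult_star_cancel_left)
    then show ?thesis using s e(1,2) by (simp add: characterD(3))
  qed
  ultimately show ?thesis
    using germ_pairs_star[OF p(1)] germ_pairs_star[OF p(2)] char_act_germ[OF assms] s(1) e(1) p(3)
    by (metis conj_idem(2) germ_eqI)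
qed

lemma ginv_germ [simp]:
  assumes "(s, \<phi>) \<in> germ_pairs S"
  shows "ginv (universal_groupoid S) (germ S s \<phi>) = germ S (star S s) (char_act S s \<phi>)"
proof -
  have "(THE x. \<exists>r \<psi>. (r, \<psi>) \<in> germ S s \<phi> \<and> x = germ S (star S r) (char_act S r \<psi>)) = germ S (star S s) (char_act S s \<phi>)"
  proof (rule the_equality)
    show "\<exists>r \<psi>. (r, \<psi>) \<in> germ S s \<phi> \<and> germ S (star S s) (char_act S s \<phi>) = germ S (star S r) (char_act S r \<psi>)"
      using germ_self[OF assms] by blast
  qed (auto dest: germ_star_cong)
  then show ?thesis by (simp add: universal_groupoid_def)
qed

lemma char_act_star_cancel:
  assumes "(s, \<phi>) \<in> germ_pairs S"
  shows "char_act S (star S s) (char_act S s \<phi>) = \<phi>"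
  using germ_pairsD[OF assms] by (simp add: char_act_idem flip: char_act_mult)

section \<open>Continuity of the structure maps and the groupoid axioms\<close>

lemma continuous_map_gdom:
  "continuous_map (germ_topology S) (character_space S) (gdom (universal_groupoid S))"
proof (rule continuous_map_from_germ_topology)
  fix s assume s: "s \<in> carrier S"
  show "continuous_map (subtopology (character_space S) (char_dom S (star S s \<otimes> s)))
      (character_space S) (\<lambda>\<phi>. gdom (universal_groupoid S) (germ S s \<phi>))"
    by (rule continuous_map_eq[OF continuous_map_from_subtopology[OF continuous_map_id]])
      (use s in \<open>auto simp: germ_pairs_def\<close>)
qed

lemma composable_cases:
  assumes "(A, B) \<in> composable (universal_groupoid S)"
  obtains s t \<psi> where "(s, char_act S t \<psi>) \<in> germ_pairs S" "(t, \<psi>) \<in> germ_pairs S"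
    "A = germ S s (char_act S t \<psi>)" "B = germ S t \<psi>"
proof -
  obtain s \<phi> t \<psi> where "(s, \<phi>) \<in> germ_pairs S" "A = germ S s \<phi>" "(t, \<psi>) \<in> germ_pairs S" "B = germ S t \<psi>"
    using assms by (auto simp: composable_def elim!: germ_cases)
  with that[of s t \<psi>] assms show ?thesis by (auto simp: composable_def)
qed

text \<open>Over a pair of basic sets belonging to \<open>s\<close> and \<open>t\<close>, the
  product is the germ of the fixed element \<open>s \<otimes> t\<close> at the domain of the second
  factor.\<close>

lemma continuous_map_gcomp:
  "continuous_map (subtopology (prod_topology (germ_topology S) (germ_topology S))
      (composable (universal_groupoid S))) (germ_topology S)
    (\<lambda>(g, h). gcomp (universal_groupoid S) g h)"
proof (rule continuous_map_locallyI)
  let ?G = "universal_groupoid S"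
  let ?P = "subtopology (prod_topology (germ_topology S) (germ_topology S)) (composable ?G)"
  fix x assume "x \<in> topspace ?P"
  then have x: "x \<in> composable ?G" by auto
  obtain A B where AB: "x = (A, B)" by fastforce
  from x obtain s t \<psi> where p: "(s, char_act S t \<psi>) \<in> germ_pairs S" "(t, \<psi>) \<in> germ_pairs S"
    and A: "A = germ S s (char_act S t \<psi>)" and B: "B = germ S t \<psi>"
    unfolding AB by (rule composable_cases)
  note s = germ_pairsD[OF p(1)] and t = germ_pairsD[OF p(2)]
  let ?V = "germ S s ` char_dom S (star S s \<otimes> s) \<times> germ S t ` char_dom S (star S t \<otimes> t)"
  let ?U = "composable ?G \<inter> ?V"
  have eq: "gcomp ?G C D = germ S (s \<otimes> t) (gdom ?G D) \<and> (s \<otimes> t, gdom ?G D) \<in> germ_pairs S"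
    if CD: "(C, D) \<in> ?U" for C D
  proof -
    obtain \<phi> \<psi> where q: "\<phi> \<in> char_dom S (star S s \<otimes> s)" "\<psi> \<in> char_dom S (star S t \<otimes> t)"
      "C = germ S s \<phi>" "D = germ S t \<psi>"
      using CD by auto
    have 1: "(s, \<phi>) \<in> germ_pairs S" "(t, \<psi>) \<in> germ_pairs S"
      using q s t by (auto simp: germ_pairs_def)
    then have "\<phi> = char_act S t \<psi>" using CD q by (auto simp: composable_def)
    with 1 q germ_pairs_mult show ?thesis by auto
  qed
  have "openin ?P ?U"
    using s(1) t(1)
    by (intro openin_subtopology_Int2) (auto simp: openin_prod_Times_iff intro!: openin_germ_image)
  moreover have "x \<in> ?U"
    using x AB A B s t by auto
  moreover have "continuous_map (subtopology ?P ?U) (germ_topology S) (germ S (s \<otimes> t) \<circ> (gdom ?G \<circ> snd))"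
  proof (rule continuous_map_compose[OF _ continuous_map_germ])
    have "continuous_map (subtopology ?P ?U) (character_space S) (gdom ?G \<circ> snd)"
      by (intro continuous_map_compose[OF _ continuous_map_gdom] continuous_map_from_subtopology
          continuous_map_snd)
    then show "continuous_map (subtopology ?P ?U) (subtopology (character_space S)
        (char_dom S (star S (s \<otimes> t) \<otimes> (s \<otimes> t)))) (gdom ?G \<circ> snd)"
    proof (rule continuous_map_into_subtopology, intro funcsetI)
      fix y assume "y \<in> topspace (subtopology ?P ?U)"
      then have "y \<in> ?U" by simp
      then show "(gdom ?G \<circ> snd) y \<in> char_dom S (star S (s \<otimes> t) \<otimes> (s \<otimes> t))"
        using eq[of "fst y" "snd y"] germ_pairsD(4) by simp
    qed
  qed (use s t in simp)
  ultimately show "\<exists>U g. openin ?P U \<and> x \<in> U \<and> continuous_map (subtopology ?P U) (germ_topology S) g \<and>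
      (\<forall>y\<in>U. (case y of (g, h) \<Rightarrow> gcomp ?G g h) = g y)"
    using eq by (intro exI[of _ ?U] exI[of _ "germ S (s \<otimes> t) \<circ> (gdom ?G \<circ> snd)"]) auto
qed

lemma topological_groupoid_universal: "topological_groupoid (universal_groupoid S)"
proof (rule topological_groupoid.intro, simp_all only: universal_groupoid_simps topspace_character_space)
  let ?G = "universal_groupoid S"
  show "continuous_map (germ_topology S) (character_space S) (gdom ?G)"
    by (rule continuous_map_gdom)
  show "continuous_map (germ_topology S) (character_space S) (grng ?G)"
  proof (rule continuous_map_from_germ_topology)
    fix s assume s: "s \<in> carrier S"
    show "continuous_map (subtopology (character_space S) (char_dom S (star S s \<otimes> s)))
        (character_space S) (\<lambda>\<phi>. grng ?G (germ S s \<phi>))"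
      by (rule continuous_map_eq[OF continuous_map_char_act[OF s]])
        (use s in \<open>auto simp: germ_pairs_def\<close>)
  qed
  show "continuous_map (germ_topology S) (germ_topology S) (ginv ?G)"
  proof (rule continuous_map_from_germ_topology)
    fix s assume s: "s \<in> carrier S"
    have "continuous_map (subtopology (character_space S) (char_dom S (star S s \<otimes> s)))
        (subtopology (character_space S) (char_dom S (star S (star S s) \<otimes> star S s))) (char_act S s)"
      using char_act_char_dom[OF s] s
      by (intro continuous_map_into_subtopology continuous_map_char_act) auto
    then have "continuous_map (subtopology (character_space S) (char_dom S (star S s \<otimes> s)))
        (germ_topology S) (germ S (star S s) \<circ> char_act S s)"
      by (rule continuous_map_compose) (rule continuous_map_germ[OF star_closed[OF s]])
    then show "continuous_map (subtopology (character_space S) (char_dom S (star S s \<otimes> s)))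
        (germ_topology S) (\<lambda>\<phi>. ginv ?G (germ S s \<phi>))"
      by (rule continuous_map_eq) (use s in \<open>auto simp: germ_pairs_def\<close>)
  qed
  show "continuous_map (character_space S) (germ_topology S) (gid ?G)"
  proof (rule continuous_map_locallyI)
    fix \<phi> assume "\<phi> \<in> topspace (character_space S)"
    then obtain e where e: "e \<in> idems S" "\<phi> \<in> char_dom S e"
      using characterD(2)[of \<phi>] by (auto simp: char_dom_def)
    moreover have "continuous_map (subtopology (character_space S) (char_dom S e)) (germ_topology S) (germ S e)"
      using continuous_map_germ[of e] e(1) by simp
    moreover have "\<forall>\<psi>\<in>char_dom S e. gid ?G \<psi> = germ S e \<psi>"
      using e by (auto simp: char_dom_def gid_eq_germ)
    ultimately show "\<exists>U g. openin (character_space S) U \<and> \<phi> \<in> U \<and>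
        continuous_map (subtopology (character_space S) U) (germ_topology S) g \<and> (\<forall>y\<in>U. gid ?G y = g y)"
      using openin_char_dom by blast
  qed
  show "continuous_map (subtopology (prod_topology (germ_topology S) (germ_topology S)) (composable ?G))
      (germ_topology S) (\<lambda>(g, h). gcomp ?G g h)"
    by (rule continuous_map_gcomp)
  show "gdom ?G (gid ?G \<phi>) = \<phi>" "grng ?G (gid ?G \<phi>) = \<phi>" if "\<phi> \<in> characters S" for \<phi>
  proof -
    obtain e where "e \<in> idems S" "\<phi> e" using characterD(2)[OF \<open>\<phi> \<in> _\<close>] by blast
    with \<open>\<phi> \<in> _\<close> show "gdom ?G (gid ?G \<phi>) = \<phi>" "grng ?G (gid ?G \<phi>) = \<phi>"
      by (simp_all add: gid_eq_germ germ_pairs_idem char_act_idem)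
  qed
  show "gdom ?G (gcomp ?G A B) = gdom ?G B" "grng ?G (gcomp ?G A B) = grng ?G A"
    if "(A, B) \<in> composable ?G" for A B
    by (rule composable_cases[OF that];
        simp add: germ_pairs_mult char_act_mult germ_pairsD(1))+
  show "gcomp ?G (gcomp ?G A B) C = gcomp ?G A (gcomp ?G B C)"
    if AB: "(A, B) \<in> composable ?G" and BC: "(B, C) \<in> composable ?G" for A B C
  proof -
    obtain s t \<psi> where B: "(s, char_act S t \<psi>) \<in> germ_pairs S" "(t, \<psi>) \<in> germ_pairs S"
      "B = germ S s (char_act S t \<psi>)" "C = germ S t \<psi>"
      using BC by (rule composable_cases)
    obtain r \<phi> where A: "(r, \<phi>) \<in> germ_pairs S" "A = germ S r \<phi>"
      using AB by (auto simp: composable_def elim!: germ_cases)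
    have \<phi>: "\<phi> = char_act S s (char_act S t \<psi>)"
      using AB A B by (auto simp: composable_def)
    note c = germ_pairsD(1)[OF A(1)] germ_pairsD(1)[OF B(1)] germ_pairsD(1)[OF B(2)]
    have "(r \<otimes> s, char_act S t \<psi>) \<in> germ_pairs S" "(s \<otimes> t, \<psi>) \<in> germ_pairs S"
      using A(1) B \<phi> germ_pairs_mult by auto
    \<comment> \<open>\<open>gcomp_germ\<close> expects the character of the left factor as an image
      under the single element \<open>s \<otimes> t\<close>.\<close>
    moreover have "(r, char_act S (s \<otimes> t) \<psi>) \<in> germ_pairs S"
      using A(1) \<phi> c by (simp add: char_act_mult)
    moreover have "A = germ S r (char_act S (s \<otimes> t) \<psi>)"
      using A(2) \<phi> c by (simp add: char_act_mult)
    ultimately have "gcomp ?G A (gcomp ?G B C) = germ S (r \<otimes> (s \<otimes> t)) \<psi>"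
      using B gcomp_germ[of r "s \<otimes> t" \<psi>] by simp
    moreover have "gcomp ?G (gcomp ?G A B) C = germ S (r \<otimes> s \<otimes> t) \<psi>"
      using A B \<phi> \<open>(r \<otimes> s, _) \<in> _\<close> by simp
    ultimately show ?thesis
      using c by (simp add: m_assoc)
  qed
  show "gcomp ?G A (gid ?G (gdom ?G A)) = A" "gcomp ?G (gid ?G (grng ?G A)) A = A"
    "gdom ?G (ginv ?G A) = grng ?G A" "grng ?G (ginv ?G A) = gdom ?G A"
    "gcomp ?G (ginv ?G A) A = gid ?G (gdom ?G A)" "gcomp ?G A (ginv ?G A) = gid ?G (grng ?G A)"
    if top: "A \<in> topspace (germ_topology S)" for A
  proof -
    obtain s \<phi> where p: "(s, \<phi>) \<in> germ_pairs S" and A: "A = germ S s \<phi>"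
      using top by (rule germ_cases)
    note s = germ_pairsD[OF p]
    have q: "(star S s, char_act S s \<phi>) \<in> germ_pairs S" "char_act S (star S s) (char_act S s \<phi>) = \<phi>"
      using p germ_pairs_star char_act_star_cancel by auto
    have d: "gid ?G \<phi> = germ S (star S s \<otimes> s) \<phi>" "char_act S (star S s \<otimes> s) \<phi> = \<phi>"
      "(star S s \<otimes> s, \<phi>) \<in> germ_pairs S"
      using s by (simp_all add: gid_eq_germ[of "star S s \<otimes> s"] char_act_idem germ_pairs_idem)
    have "char_act S s \<phi> \<in> characters S" "char_act S s \<phi> (s \<otimes> star S s)"
      using char_act_char_dom[OF s(1,4)] unfolding char_dom_def by blast+
    then have r: "gid ?G (char_act S s \<phi>) = germ S (s \<otimes> star S s) (char_act S s \<phi>)"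
      "(s \<otimes> star S s, char_act S s \<phi>) \<in> germ_pairs S"
      using gid_eq_germ germ_pairs_idem mult_star_idem[OF s(1)] by blast+
    show "gcomp ?G A (gid ?G (gdom ?G A)) = A"
      using gcomp_germ[of s "star S s \<otimes> s" \<phi>] p A d s(1) by simp
    show "gcomp ?G (gid ?G (grng ?G A)) A = A"
      using gcomp_germ[of "s \<otimes> star S s" s \<phi>] p A r s(1) by (simp add: m_assoc)
    show "gdom ?G (ginv ?G A) = grng ?G A" "grng ?G (ginv ?G A) = gdom ?G A"
      using p q A by simp_all
    show "gcomp ?G (ginv ?G A) A = gid ?G (gdom ?G A)"
      using gcomp_germ[of "star S s" s \<phi>] p q A d by simp
    show "gcomp ?G A (ginv ?G A) = gid ?G (grng ?G A)"
      using gcomp_germ[of s "star S s" "char_act S s \<phi>"] p q A r by simp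
  qed
qed

text \<open>On a basic set, the section \<open>germ S s\<close> is a continuous inverse of the
  domain map.\<close>

lemma local_homeomorphism_gdom:
  "local_homeomorphism (germ_topology S) (character_space S) (gdom (universal_groupoid S))"
  unfolding local_homeomorphism_def
proof
  let ?d = "gdom (universal_groupoid S)"
  fix A assume "A \<in> topspace (germ_topology S)"
  then obtain s \<phi> where p: "(s, \<phi>) \<in> germ_pairs S" and A: "A = germ S s \<phi>"
    by (rule germ_cases)
  note s = germ_pairsD[OF p]
  let ?D = "char_dom S (star S s \<otimes> s)"
  let ?U = "germ S s ` ?D"
  have d: "?d (germ S s \<psi>) = \<psi>" if "\<psi> \<in> ?D" for \<psi>
    using that s(1) by (simp add: germ_pairs_def)
  then have dU: "?d ` ?U = ?D" by force
  have "homeomorphic_maps (subtopology (germ_topology S) ?U) (subtopology (character_space S) ?D) ?d (germ S s)"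
    unfolding homeomorphic_maps_def
  proof (intro conjI continuous_map_into_subtopology)
    show "continuous_map (subtopology (germ_topology S) ?U) (character_space S) ?d"
      by (intro continuous_map_from_subtopology continuous_map_gdom)
    show "continuous_map (subtopology (character_space S) ?D) (germ_topology S) (germ S s)"
      by (rule continuous_map_germ[OF s(1)])
  qed (use d in auto)
  then have "homeomorphic_map (subtopology (germ_topology S) ?U) (subtopology (character_space S) (?d ` ?U)) ?d"
    unfolding dU by (rule homeomorphic_maps_imp_map)
  moreover have "openin (germ_topology S) ?U"
    using s(1) by (intro openin_germ_image) auto
  moreover have "openin (character_space S) (?d ` ?U)"
    unfolding dU using s(1) by simp
  ultimately show "\<exists>U. openin (germ_topology S) U \<and> A \<in> U \<and> openin (character_space S) (?d ` U) \<and>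
      homeomorphic_map (subtopology (germ_topology S) U) (subtopology (character_space S) (?d ` U)) ?d"
    using A s(4) by blast
qed

lemma etale_groupoid_universal: "etale_groupoid (universal_groupoid S)"
  by (simp add: etale_groupoid_def topological_groupoid_universal lc_hausdorff_character_space
      local_homeomorphism_gdom)

end


section \<open>Morita contexts\<close>

context morita_context
begin

section \<open>Calculus of the two pairings\<close>

declare lact_closed [simp] ract_closed [simp] lprod_self [simp] rprod_self [simp]

lemma lprod_closed [simp]: "x \<in> X \<Longrightarrow> y \<in> X \<Longrightarrow> lprod x y \<in> carrier S"
  using lprod_onto by fastforce

lemma rprod_closed [simp]: "x \<in> X \<Longrightarrow> y \<in> X \<Longrightarrow> rprod x y \<in> carrier T"
  using rprod_onto by fastforce

lemma star_lprod [simp]: "x \<in> X \<Longrightarrow> y \<in> X \<Longrightarrow> star S (lprod x y) = lprod y x"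
  by (rule lprod_star[symmetric])

lemma star_rprod [simp]: "x \<in> X \<Longrightarrow> y \<in> X \<Longrightarrow> star T (rprod x y) = rprod y x"
  by (rule rprod_star[symmetric])

lemma lprod_lact_right:
  assumes "s \<in> carrier S" "x \<in> X" "y \<in> X"
  shows "lprod x (lact s y) = lprod x y \<otimes>\<^bsub>S\<^esub> star S s"
proof -
  have "star S (lprod (lact s y) x) = lprod x y \<otimes>\<^bsub>S\<^esub> star S s"
    using assms by (simp only: lprod_lact S.star_mult lprod_closed star_lprod)
  with assms show ?thesis by simp
qed

lemma rprod_ract_left:
  assumes "t \<in> carrier T" "x \<in> X" "y \<in> X"
  shows "rprod (ract x t) y = star T t \<otimes>\<^bsub>T\<^esub> rprod x y"
proof -
  have "star T (rprod y (ract x t)) = star T t \<otimes>\<^bsub>T\<^esub> rprod x y"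
    using assms by (simp only: rprod_ract T.star_mult rprod_closed star_rprod)
  with assms show ?thesis by simp
qed

lemma rprod_mult:
  assumes "x \<in> X" "y \<in> X" "z \<in> X" "w \<in> X"
  shows "rprod x y \<otimes>\<^bsub>T\<^esub> rprod z w = rprod x (lact (lprod y z) w)"
  using assms by (simp add: lprod_rprod rprod_ract)

lemma lprod_mult:
  assumes "x \<in> X" "y \<in> X" "z \<in> X" "w \<in> X"
  shows "lprod x y \<otimes>\<^bsub>S\<^esub> lprod z w = lprod (ract x (rprod y z)) w"
  using assms by (simp add: lprod_lact flip: lprod_rprod)

text \<open>The axioms relate \<open>lprod\<close> to the action of \<open>S\<close> only. Writing
  \<open>t\<close> as a value of \<open>rprod\<close> turns its action into one of \<open>S\<close>,
  by \<open>lprod_rprod\<close>.\<close>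

lemma lprod_ract:
  assumes t: "t \<in> carrier T" and x: "x \<in> X" and y: "y \<in> X"
  shows "lprod (ract x t) y = lprod x (ract y (star T t))"
proof -
  obtain a b where ab: "a \<in> X" "b \<in> X" "t = rprod a b"
    using t unfolding rprod_onto[symmetric] by auto
  have "lprod (ract x t) y = lprod x a \<otimes>\<^bsub>S\<^esub> lprod b y"
    using ab x y by (simp add: lprod_mult)
  also have "\<dots> = lprod x (lact (lprod y b) a)"
    using ab x y by (simp add: lprod_lact_right)
  also have "lact (lprod y b) a = ract y (star T t)"
    using ab x y by (simp add: lprod_rprod)
  finally show ?thesis .
qed

lemma rprod_lact:
  assumes s: "s \<in> carrier S" and x: "x \<in> X" and y: "y \<in> X"
  shows "rprod (lact s x) y = rprod x (lact (star S s) y)"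
proof -
  obtain a b where ab: "a \<in> X" "b \<in> X" "s = lprod a b"
    using s unfolding lprod_onto[symmetric] by auto
  have "rprod (lact s x) y = rprod x b \<otimes>\<^bsub>T\<^esub> rprod a y"
    using ab x y by (simp add: lprod_rprod rprod_ract_left)
  also have "\<dots> = rprod x (lact (star S s) y)"
    using ab x y by (simp add: rprod_mult)
  finally show ?thesis .
qed

text \<open>Since \<open>star\<close> reverses products, it exchanges left and right actions.
  Interpreting the locale a second time along this fact yields the mirror image of each
  result.\<close>

lemma swap: "morita_context T S X (\<lambda>t x. ract x (star T t)) (\<lambda>x s. lact (star S s) x) rprod lprod"
proof (intro morita_context.intro morita_context_axioms.intro)
  show "inverse_semigroup T" "inverse_semigroup S" by unfold_locales
qed (simp_all add: T.star_mult S.star_mult ract_mult lact_mult act_commute lprod_onto rprod_onto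
    rprod_ract_left lprod_lact_right lprod_rprod)

lemma rprod_self_mult [simp]:
  assumes "x \<in> X" "y \<in> X"
  shows "rprod x x \<otimes>\<^bsub>T\<^esub> rprod x y = rprod x y"
  using rprod_ract_left[of "rprod x x" x y] assms by simp

lemma rprod_self_idem [simp]: "x \<in> X \<Longrightarrow> rprod x x \<in> idems T"
  by (rule T.idemsI) simp_all

lemma lprod_self_idem [simp]: "x \<in> X \<Longrightarrow> lprod x x \<in> idems S"
  using lprod_lact[of "lprod x x" x x] by (intro S.idemsI) simp_all

text \<open>The factor \<open>lprod x x\<close> that arises between \<open>s\<close> and
  \<open>e\<close> commutes past \<open>e\<close> and then fixes \<open>x\<close>. For idempotent
  \<open>s\<close> and \<open>y = x\<close> this makes \<open>e \<mapsto> rprod x (lact e x)\<close>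
  multiplicative; for general \<open>s\<close> it carries witnesses of equal germs from
  \<open>S\<close> to \<open>T\<close>.\<close>

lemma rprod_lact_mult:
  assumes "s \<in> carrier S" "e \<in> idems S" "x \<in> X" "y \<in> X"
  shows "rprod y (lact s x) \<otimes>\<^bsub>T\<^esub> rprod x (lact e x) = rprod y (lact (s \<otimes>\<^bsub>S\<^esub> e) x)"
proof -
  have "rprod y (lact s x) \<otimes>\<^bsub>T\<^esub> rprod x (lact e x) =
      rprod y (lact (s \<otimes>\<^bsub>S\<^esub> lprod x x \<otimes>\<^bsub>S\<^esub> e) x)"
    using assms by (simp add: rprod_mult lprod_lact lact_mult)
  also have "s \<otimes>\<^bsub>S\<^esub> lprod x x \<otimes>\<^bsub>S\<^esub> e = s \<otimes>\<^bsub>S\<^esub> e \<otimes>\<^bsub>S\<^esub> lprod x x"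
    using assms by (simp add: S.m_assoc S.idems_commute)
  also have "lact (s \<otimes>\<^bsub>S\<^esub> e \<otimes>\<^bsub>S\<^esub> lprod x x) x = lact (s \<otimes>\<^bsub>S\<^esub> e) x"
    using assms by (simp add: lact_mult)
  finally show ?thesis .
qed

lemma rprod_lact_idem [simp]:
  assumes "e \<in> idems S" "x \<in> X"
  shows "rprod x (lact e x) \<in> idems T"
  using assms rprod_lact_mult[of e e x x] by (intro T.idemsI) simp_all

text \<open>The action of \<open>X\<close> on characters, which extends the actions of \<open>S\<close> and \<open>T\<close> on theirs:
  \<open>s\<^sup>* e s\<close> is \<open>[s, e s]\<close> in the Morita context of \<open>S\<close> with itself.\<close>

definition transport :: "'x \<Rightarrow> ('t \<Rightarrow> bool) \<Rightarrow> 's \<Rightarrow> bool" where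
  "transport x \<phi> = (\<lambda>e\<in>idems S. \<phi> (rprod x (lact e x)))"

lemma transport_apply [simp]: "e \<in> idems S \<Longrightarrow> transport x \<phi> e = \<phi> (rprod x (lact e x))"
  by (simp add: transport_def)

lemma transport_char_dom:
  assumes x: "x \<in> X" and \<phi>: "\<phi> \<in> char_dom T (rprod x x)"
  shows "transport x \<phi> \<in> char_dom S (lprod x x)"
proof -
  have \<phi>': "\<phi> \<in> characters T" "\<phi> (rprod x x)"
    using \<phi> by (auto simp: char_dom_def)
  have 1: "transport x \<phi> (lprod x x)"
    using x \<phi>' by simp
  have 2: "transport x \<phi> (e \<otimes>\<^bsub>S\<^esub> f) \<longleftrightarrow> transport x \<phi> e \<and> transport x \<phi> f"
    if "e \<in> idems S" "f \<in> idems S" for e f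
    using that x by (simp add: T.characterD(3)[OF \<phi>'(1)] flip: rprod_lact_mult)
  have "transport x \<phi> \<in> characters S"
    unfolding characters_def
  proof (intro CollectI conjI ballI 2)
    show "transport x \<phi> \<in> idems S \<rightarrow>\<^sub>E UNIV" by (simp add: transport_def)
    show "\<exists>e\<in>idems S. transport x \<phi> e" using 1 lprod_self_idem[OF x] by blast
  qed
  with 1 show ?thesis by (simp add: char_dom_def)
qed

lemma continuous_map_transport:
  assumes "x \<in> X"
  shows "continuous_map (subtopology (character_space T) (char_dom T (rprod x x)))
    (character_space S) (transport x)"
proof (rule S.continuous_map_into_character_space)
  fix e assume "e \<in> idems S"
  then show "continuous_map (subtopology (character_space T) (char_dom T (rprod x x)))
      (discrete_topology UNIV) (\<lambda>\<phi>. transport x \<phi> e)"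
    using assms by (auto intro!: continuous_map_from_subtopology T.continuous_map_char_eval)
qed (use transport_char_dom[OF assms] in \<open>auto simp: char_dom_def\<close>)

text \<open>Moving \<open>s\<close> to the other argument of \<open>rprod\<close> produces the
  conjugate of \<open>e\<close> that defines \<open>char_act\<close>.\<close>

lemma transport_lact:
  assumes "x \<in> X" "s \<in> carrier S"
  shows "transport (lact s x) \<phi> = char_act S s (transport x \<phi>)"
proof
  fix e
  show "transport (lact s x) \<phi> e = char_act S s (transport x \<phi>) e"
  proof (cases "e \<in> idems S")
    case True
    with assms show ?thesis by (simp add: rprod_lact lact_mult)
  qed (simp add: transport_def char_act_def)
qed

interpretation swap: morita_context T S X "\<lambda>t x. ract x (star T t)" "\<lambda>x s. lact (star S s) x" rprod lprod
  by (rule swap)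

text \<open>The composite evaluates \<phi> at
  \<open>rprod x x \<otimes> f \<otimes> rprod x x\<close>, and \<phi> is 1 at the outer
  factors.\<close>

lemma transport_swap_transport:
  assumes x: "x \<in> X" and \<phi>: "\<phi> \<in> char_dom T (rprod x x)"
  shows "swap.transport x (transport x \<phi>) = \<phi>"
proof (rule T.character_eqI)
  have \<phi>': "\<phi> \<in> characters T" "\<phi> (rprod x x)"
    using \<phi> by (auto simp: char_dom_def)
  show "swap.transport x (transport x \<phi>) \<in> characters T"
    using swap.transport_char_dom[OF x transport_char_dom[OF x \<phi>]] by (simp add: char_dom_def)
  show "\<phi> \<in> characters T" by fact
  fix f assume f: "f \<in> idems T"
  have "lprod x (ract x f) \<in> idems S"
    using swap.rprod_lact_idem[OF f x] f by simp
  moreover have "rprod x (lact (lprod x (ract x f)) x) = rprod x x \<otimes>\<^bsub>T\<^esub> (f \<otimes>\<^bsub>T\<^esub> rprod x x)"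
    using x f by (simp add: lprod_rprod rprod_ract rprod_ract_left)
  ultimately show "swap.transport x (transport x \<phi>) f = \<phi> f"
    using f x \<phi>' by (simp add: T.characterD(3))
qed

text \<open>In the following lemmas \<open>\<phi>\<close>, \<open>\<phi>'\<close> are characters of \<open>E(T)\<close> with images \<open>x\<phi>\<close>, \<open>x'\<phi>'\<close>, and
  the arrow of \<open>s\<close> from \<open>x\<phi>\<close> to \<open>x'\<phi>'\<close> is pulled back to the arrow of \<open>[x', s x]\<close> from \<open>\<phi>\<close> to \<open>\<phi>'\<close>.\<close>

lemma pullback_conj:
  assumes s: "s \<in> carrier S" and x: "x \<in> X" and x': "x' \<in> X" and \<phi>': "\<phi>' \<in> char_dom T (rprod x' x')"
    and act: "char_act S s (transport x \<phi>) = transport x' \<phi>'" and f: "f \<in> idems T"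
  shows "\<phi> (star T (rprod x' (lact s x)) \<otimes>\<^bsub>T\<^esub> f \<otimes>\<^bsub>T\<^esub> rprod x' (lact s x)) \<longleftrightarrow> \<phi>' f"
proof -
  \<comment> \<open>The counterpart of \<open>f\<close> in \<open>S\<close>: evaluating
    \<open>transport x' \<phi>'\<close> there returns \<open>\<phi>' f\<close>, because the two
    transports are inverse.\<close>
  let ?g = "lprod x' (ract x' f)"
  have g: "?g \<in> idems S" "lprod (ract x' f) x' = ?g"
    using swap.rprod_lact_idem[OF f x'] f x' by (simp_all add: lprod_ract)
  have "star T (rprod x' (lact s x)) \<otimes>\<^bsub>T\<^esub> f \<otimes>\<^bsub>T\<^esub> rprod x' (lact s x) =
      rprod (lact s x) (ract x' f) \<otimes>\<^bsub>T\<^esub> rprod x' (lact s x)"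
    using s x x' f by (simp add: rprod_ract)
  also have "\<dots> = rprod (lact s x) (lact ?g (lact s x))"
    using s x x' f g by (simp add: rprod_mult)
  finally have "\<phi> (star T (rprod x' (lact s x)) \<otimes>\<^bsub>T\<^esub> f \<otimes>\<^bsub>T\<^esub> rprod x' (lact s x)) \<longleftrightarrow>
      transport (lact s x) \<phi> ?g"
    using g by simp
  also have "\<dots> \<longleftrightarrow> transport x' \<phi>' ?g"
    using transport_lact[OF x s] act by simp
  also have "\<dots> \<longleftrightarrow> swap.transport x' (transport x' \<phi>') f"
    using f by simp
  finally show ?thesis
    using transport_swap_transport[OF x' \<phi>'] by simp
qed

text \<open>Both claims come from \<open>pullback_conj\<close>. At \<open>f = rprod x' x'\<close>,
  which fixes \<open>rprod x' (lact s x)\<close> from the left, it shows that \<phi> is 1 at the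
  domain idempotent; for arbitrary \<open>f\<close> it identifies the range.\<close>

lemma pullback_germ_pairs:
  assumes s: "s \<in> carrier S" and x: "x \<in> X" and x': "x' \<in> X"
    and \<phi>: "\<phi> \<in> char_dom T (rprod x x)" and \<phi>': "\<phi>' \<in> char_dom T (rprod x' x')"
    and act: "char_act S s (transport x \<phi>) = transport x' \<phi>'"
  shows "(rprod x' (lact s x), \<phi>) \<in> germ_pairs T"
    and "char_act T (rprod x' (lact s x)) \<phi> = \<phi>'"
proof -
  let ?t = "rprod x' (lact s x)"
  have "\<phi> (star T ?t \<otimes>\<^bsub>T\<^esub> rprod x' x' \<otimes>\<^bsub>T\<^esub> ?t)"
    using pullback_conj[OF s x x' \<phi>' act, of "rprod x' x'"] x' \<phi>' by (simp add: char_dom_def)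
  then have "\<phi> (star T ?t \<otimes>\<^bsub>T\<^esub> ?t)"
    using s x x' by (simp add: T.m_assoc del: star_rprod)
  then show p: "(?t, \<phi>) \<in> germ_pairs T"
    using s x x' \<phi> by (intro T.germ_pairsI) (auto simp: char_dom_def)
  show "char_act T ?t \<phi> = \<phi>'"
  proof (rule T.character_eqI)
    show "char_act T ?t \<phi> \<in> characters T"
      using T.germ_pairsD[OF p] by (intro T.char_act_characters)
    show "\<phi>' \<in> characters T" using \<phi>' by (simp add: char_dom_def)
    show "char_act T ?t \<phi> f = \<phi>' f" if "f \<in> idems T" for f
      using pullback_conj[OF s x x' \<phi>' act that] that by simp
  qed
qed

text \<open>A witness \<open>e\<close> over \<open>S\<close> is carried to
  \<open>rprod x (lact e x)\<close>, where \<phi> is 1 by the definition of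
  \<open>transport\<close>.\<close>

lemma pullback_germ_cong:
  assumes x: "x \<in> X" and x': "x' \<in> X"
    and \<phi>: "\<phi> \<in> char_dom T (rprod x x)" and \<phi>': "\<phi>' \<in> char_dom T (rprod x' x')"
    and act: "char_act S s (transport x \<phi>) = transport x' \<phi>'"
    and r: "(r, transport x \<phi>) \<in> germ S s (transport x \<phi>)"
  shows "germ T (rprod x' (lact r x)) \<phi> = germ T (rprod x' (lact s x)) \<phi>"
proof -
  let ?\<rho> = "transport x \<phi>"
  obtain e where p: "(s, ?\<rho>) \<in> germ_pairs S" "(r, ?\<rho>) \<in> germ_pairs S"
    and e: "e \<in> idems S" "?\<rho> e" "s \<otimes>\<^bsub>S\<^esub> e = r \<otimes>\<^bsub>S\<^esub> e"
    using r unfolding S.mem_germ_iff by blast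
  note sr = S.germ_pairsD(1)[OF p(1)] S.germ_pairsD(1)[OF p(2)]
  have act': "char_act S r ?\<rho> = transport x' \<phi>'"
    using S.char_act_germ[OF r] act by simp
  have "rprod x' (lact r x) \<otimes>\<^bsub>T\<^esub> rprod x (lact e x) = rprod x' (lact s x) \<otimes>\<^bsub>T\<^esub> rprod x (lact e x)"
    using sr e(1,3) x x' by (simp add: rprod_lact_mult)
  moreover have "\<phi> (rprod x (lact e x))" using e(1,2) by simp
  ultimately show ?thesis
    using T.germ_eqI[OF pullback_germ_pairs(1)[OF sr(2) x x' \<phi> \<phi>' act']
        pullback_germ_pairs(1)[OF sr(1) x x' \<phi> \<phi>' act] rprod_lact_idem[OF e(1) x]] by blast
qed

text \<open>The element on the left equals
  \<open>lprod x' x' \<otimes> s \<otimes> lprod x x\<close>; the range and domain characters are 1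
  at the outer factors, so the germ is that of \<open>s\<close>. The \<open>star\<close> is the one
  built into the swapped left action.\<close>

lemma pullback_inverse:
  assumes x: "x \<in> X" and x': "x' \<in> X" and p: "(s, transport x \<phi>) \<in> germ_pairs S"
    and \<phi>: "\<phi> \<in> char_dom T (rprod x x)" and \<phi>': "\<phi>' \<in> char_dom T (rprod x' x')"
    and act: "char_act S s (transport x \<phi>) = transport x' \<phi>'"
  shows "germ S (lprod x' (ract x (star T (rprod x' (lact s x))))) (transport x \<phi>) =
    germ S s (transport x \<phi>)"
proof -
  have s: "s \<in> carrier S" using p by (rule S.germ_pairsD)
  have "lprod x' (ract x (star T (rprod x' (lact s x)))) = lprod (ract x' (rprod x' (lact s x))) x"
    using s x x' by (simp add: lprod_ract)
  also have "\<dots> = lprod x' x' \<otimes>\<^bsub>S\<^esub> s \<otimes>\<^bsub>S\<^esub> lprod x x"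
    using s x x' by (simp add: lprod_lact S.m_assoc flip: lprod_rprod)
  finally have *: "lprod x' (ract x (star T (rprod x' (lact s x)))) =
    lprod x' x' \<otimes>\<^bsub>S\<^esub> s \<otimes>\<^bsub>S\<^esub> lprod x x" .
  have "transport x \<phi> (lprod x x)" "char_act S s (transport x \<phi>) (lprod x' x')"
    using transport_char_dom[OF x \<phi>] transport_char_dom[OF x' \<phi>'] act by (simp_all add: char_dom_def)
  then have "(lprod x' x' \<otimes>\<^bsub>S\<^esub> s \<otimes>\<^bsub>S\<^esub> lprod x x, transport x \<phi>) \<in> germ S s (transport x \<phi>)"
    using x x' by (intro S.germ_insert_idem[OF p]) simp_all
  then show ?thesis unfolding * by (rule S.germ_eq_if_mem)
qed

end


section \<open>The isomorphism of pullback groupoids\<close>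

text \<open>With \<open>Z\<close> abstract, exchanging \<open>S\<close> and \<open>T\<close> keeps
  \<open>Z\<close> and \<open>\<xi>\<close> and swaps \<open>f1\<close> with \<open>f2\<close>, and
  the type of \<open>Z\<close> can be chosen later. Continuity into a discrete space says that
  \<open>\<xi>\<close> is locally constant.\<close>

locale morita_bundle = morita_context S T X lact ract lprod rprod
  for S :: "('s, 'm) sgrp_scheme" and T :: "('t, 'n) sgrp_scheme"
    and X :: "'x set" and lact ract lprod rprod +
  fixes Z :: "'z topology" and \<xi> :: "'z \<Rightarrow> 'x" and f1 :: "'z \<Rightarrow> 's \<Rightarrow> bool" and f2 :: "'z \<Rightarrow> 't \<Rightarrow> bool"
  assumes continuous_\<xi>: "continuous_map Z (discrete_topology X) \<xi>"
    and continuous_f1: "continuous_map Z (character_space S) f1"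
    and continuous_f2: "continuous_map Z (character_space T) f2"
    and f2_rprod: "z \<in> topspace Z \<Longrightarrow> f2 z (rprod (\<xi> z) (\<xi> z))"
    and f1_eq: "z \<in> topspace Z \<Longrightarrow> f1 z = transport (\<xi> z) (f2 z)"
begin

lemma \<xi>_X [simp]: "z \<in> topspace Z \<Longrightarrow> \<xi> z \<in> X"
  using continuous_map_funspace[OF continuous_\<xi>] by auto

lemma f2_char_dom: "z \<in> topspace Z \<Longrightarrow> f2 z \<in> char_dom T (rprod (\<xi> z) (\<xi> z))"
  using continuous_map_funspace[OF continuous_f2] f2_rprod by (auto simp: char_dom_def)

interpretation swap: morita_context T S X "\<lambda>t x. ract x (star T t)" "\<lambda>x s. lact (star S s) x" rprod lprod
  by (rule swap)

lemma swap_bundle: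
  "morita_bundle T S X (\<lambda>t x. ract x (star T t)) (\<lambda>x s. lact (star S s) x) rprod lprod Z \<xi> f2 f1"
proof (intro morita_bundle.intro morita_bundle_axioms.intro swap continuous_\<xi> continuous_f1 continuous_f2)
  fix z assume z: "z \<in> topspace Z"
  show "f1 z (lprod (\<xi> z) (\<xi> z))"
    using transport_char_dom[OF \<xi>_X f2_char_dom] f1_eq z by (simp add: char_dom_def)
  show "f2 z = swap.transport (\<xi> z) (f1 z)"
    using transport_swap_transport[OF \<xi>_X f2_char_dom] f1_eq z by simp
qed

section \<open>The map on arrows\<close>

abbreviation "G1 \<equiv> pullback_groupoid (universal_groupoid S) Z f1"
abbreviation "G2 \<equiv> pullback_groupoid (universal_groupoid T) Z f2"

text \<open>On arrows of \<open>G1\<close> the choice of the representative does not matter, by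
  \<open>arrow_map_germ\<close>.\<close>

definition arrow_map :: "'z \<times> 's germ_class \<times> 'z \<Rightarrow> 'z \<times> 't germ_class \<times> 'z" where
  "arrow_map = (\<lambda>(z', A, z).
    (z', germ T (rprod (\<xi> z') (lact (SOME s. \<exists>\<rho>. (s, \<rho>) \<in> A) (\<xi> z))) (f2 z), z))"

lemma pullback_arrow_cases:
  assumes a: "(z', A, z) \<in> topspace (arrows G1)"
  obtains s where "z \<in> topspace Z" "z' \<in> topspace Z" "(s, f1 z) \<in> germ_pairs S"
    "char_act S s (f1 z) = f1 z'" "A = germ S s (f1 z)"
proof -
  have b: "z \<in> topspace Z" "z' \<in> topspace Z" "A \<in> topspace (germ_topology S)"
    "gdom (universal_groupoid S) A = f1 z" "grng (universal_groupoid S) A = f1 z'"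
    using a by (simp_all add: pullback_groupoid_def)
  obtain s \<rho> where s: "(s, \<rho>) \<in> germ_pairs S" "A = germ S s \<rho>"
    using b(3) by (rule S.germ_cases)
  then have "\<rho> = f1 z" using b(4) by simp
  with that[of s] s b show ?thesis by simp
qed

lemma arrow_pullback:
  assumes "z \<in> topspace Z" "z' \<in> topspace Z" "(s, f1 z) \<in> germ_pairs S" "char_act S s (f1 z) = f1 z'"
  shows "(rprod (\<xi> z') (lact s (\<xi> z)), f2 z) \<in> germ_pairs T"
    and "char_act T (rprod (\<xi> z') (lact s (\<xi> z))) (f2 z) = f2 z'"
    and "(r, f1 z) \<in> germ S s (f1 z) \<Longrightarrow>
      germ T (rprod (\<xi> z') (lact r (\<xi> z))) (f2 z) = germ T (rprod (\<xi> z') (lact s (\<xi> z))) (f2 z)"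
  using assms f1_eq f2_char_dom pullback_germ_pairs[of s "\<xi> z" "\<xi> z'" "f2 z" "f2 z'"] S.germ_pairsD(1)[OF assms(3)]
    pullback_germ_cong[of "\<xi> z" "\<xi> z'" "f2 z" "f2 z'" s r]
  by simp_all

lemma arrow_map_germ:
  assumes "z \<in> topspace Z" "z' \<in> topspace Z" "(s, f1 z) \<in> germ_pairs S" "char_act S s (f1 z) = f1 z'"
  shows "arrow_map (z', germ S s (f1 z), z) = (z', germ T (rprod (\<xi> z') (lact s (\<xi> z))) (f2 z), z)"
proof -
  define r where "r = (SOME r. \<exists>\<rho>. (r, \<rho>) \<in> germ S s (f1 z))"
  have "\<exists>\<rho>. (r, \<rho>) \<in> germ S s (f1 z)"
    unfolding r_def by (rule someI_ex) (use S.germ_self[OF assms(3)] in blast)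
  then have "(r, f1 z) \<in> germ S s (f1 z)"
    by (auto simp: S.mem_germ_iff)
  then show ?thesis
    using arrow_pullback(3)[OF assms] by (simp add: arrow_map_def r_def)
qed

lemma arrow_map_arrow:
  assumes "a \<in> topspace (arrows G1)"
  shows "arrow_map a \<in> topspace (arrows G2)"
proof -
  obtain z' A z where a: "a = (z', A, z)" by (cases a)
  then obtain s where s: "z \<in> topspace Z" "z' \<in> topspace Z" "(s, f1 z) \<in> germ_pairs S"
    "char_act S s (f1 z) = f1 z'" "A = germ S s (f1 z)"
    using assms pullback_arrow_cases by blast
  then show ?thesis
    using arrow_map_germ[OF s(1-4)] arrow_pullback(1,2)[OF s(1-4)] a
    by (simp add: pullback_groupoid_def T.germ_in_topspace)
qed

text \<open>Near a given arrow \<open>\<xi>\<close> is constant at both ends and all germs have a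
  common representative \<open>s\<close>. One element of \<open>T\<close> then serves for the whole
  neighbourhood, and the middle component is its section composed with \<open>f2\<close>.\<close>

lemma continuous_arrow_map: "continuous_map (arrows G1) (arrows G2) arrow_map"
proof -
  let ?Y = "prod_topology Z (prod_topology (germ_topology T) Z)"
  let ?P = "prod_topology Z (prod_topology (germ_topology S) Z)"
  have arr: "arrows G1 = subtopology ?P {(z', A, z). gdom (universal_groupoid S) A = f1 z \<and>
      grng (universal_groupoid S) A = f1 z'}"
    by (simp add: pullback_groupoid_def)
  have "continuous_map (arrows G1) ?Y arrow_map"
  proof (rule continuous_map_locallyI)
    fix a assume a: "a \<in> topspace (arrows G1)"
    obtain z0' A0 z0 where a0: "a = (z0', A0, z0)" by (cases a)
    then obtain s where s: "z0 \<in> topspace Z" "z0' \<in> topspace Z" "(s, f1 z0) \<in> germ_pairs S"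
      "char_act S s (f1 z0) = f1 z0'" "A0 = germ S s (f1 z0)"
      using a pullback_arrow_cases by blast
    note sc = S.germ_pairsD[OF s(3)]
    let ?D = "char_dom S (star S s \<otimes>\<^bsub>S\<^esub> s)"
    let ?x = "\<xi> z0" and ?x' = "\<xi> z0'"
    let ?t = "rprod ?x' (lact s ?x)"
    let ?N = "\<lambda>x. {z \<in> topspace Z. \<xi> z = x}"
    let ?V = "?N ?x' \<times> germ S s ` ?D \<times> ?N ?x"
    let ?U = "topspace (arrows G1) \<inter> ?V"
    let ?g = "\<lambda>(z', A, z). (z', germ T ?t (f2 z), z)"
    have N: "openin Z (?N x)" if "x \<in> X" for x
      using openin_continuous_map_preimage[OF continuous_\<xi>, of "{x}"] that by simp
    have V: "openin ?P ?V"
      using s sc by (simp add: openin_prod_Times_iff N S.openin_germ_image)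
    have "openin (arrows G1) ?U"
    proof -
      have "?U = {(z', A, z). gdom (universal_groupoid S) A = f1 z \<and>
          grng (universal_groupoid S) A = f1 z'} \<inter> ?V"
        using openin_subset[OF V] unfolding arr topspace_subtopology by blast
      then show ?thesis unfolding arr using openin_subtopology_Int2[OF V] by simp
    qed
    moreover have "a \<in> ?U"
      using a a0 s sc by auto
    moreover have eq: "arrow_map b = ?g b \<and> (?t, f2 (snd (snd b))) \<in> germ_pairs T" if b: "b \<in> ?U" for b
    proof -
      obtain z' A z where b': "b = (z', A, z)" by (cases b)
      then obtain r where r: "z \<in> topspace Z" "z' \<in> topspace Z" "(r, f1 z) \<in> germ_pairs S"
        "char_act S r (f1 z) = f1 z'" "A = germ S r (f1 z)"
        using b pullback_arrow_cases by blast
      obtain \<rho> where \<rho>: "\<rho> \<in> ?D" "A = germ S s \<rho>"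
        using b b' by auto
      then have p: "(s, \<rho>) \<in> germ_pairs S" using sc by (simp add: germ_pairs_def)
      \<comment> \<open>Comparing domains shows that \<open>s\<close> represents the germ of this
        arrow as well, so it can replace \<open>r\<close>.\<close>
      have "\<rho> = f1 z" using r(3,5) \<rho>(2) p S.gdom_germ by metis
      with p \<rho> r have q: "(s, f1 z) \<in> germ_pairs S" "A = germ S s (f1 z)" by simp_all
      then have "char_act S s (f1 z) = f1 z'"
        using r(3,4,5) S.grng_germ by metis
      note q' = r(1,2) q(1) this
      have "\<xi> z' = ?x'" "\<xi> z = ?x" using b b' by auto
      then show ?thesis
        using arrow_map_germ[OF q'] arrow_pullback(1)[OF q'] b' q by simp
    qed
    moreover have "continuous_map (subtopology (arrows G1) ?U) ?Y ?g"
    proof -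
      let ?W = "subtopology (arrows G1) ?U"
      have f: "continuous_map ?W Z fst" "continuous_map ?W Z (snd \<circ> snd)"
        unfolding arr by (intro continuous_map_from_subtopology continuous_map_fst
            continuous_map_compose[OF continuous_map_snd continuous_map_snd])+
      have "continuous_map ?W (subtopology (character_space T) (char_dom T (star T ?t \<otimes>\<^bsub>T\<^esub> ?t)))
          (f2 \<circ> (snd \<circ> snd))"
      proof (intro continuous_map_into_subtopology funcsetI)
        show "continuous_map ?W (character_space T) (f2 \<circ> (snd \<circ> snd))"
          by (rule continuous_map_compose[OF f(2) continuous_f2])
        fix b assume "b \<in> topspace ?W"
        then have "b \<in> ?U" by simp
        then show "(f2 \<circ> (snd \<circ> snd)) b \<in> char_dom T (star T ?t \<otimes>\<^bsub>T\<^esub> ?t)"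
          using eq T.germ_pairsD(4) by fastforce
      qed
      then have "continuous_map ?W (germ_topology T) (germ T ?t \<circ> (f2 \<circ> (snd \<circ> snd)))"
        using s sc by (intro continuous_map_compose[OF _ T.continuous_map_germ]) simp_all
      then have "continuous_map ?W ?Y (\<lambda>b. (fst b, (germ T ?t \<circ> (f2 \<circ> (snd \<circ> snd))) b, (snd \<circ> snd) b))"
        using f by (intro continuous_map_pairedI) (simp_all add: o_def)
      then show ?thesis by (rule continuous_map_eq) auto
    qed
    ultimately show "\<exists>U g. openin (arrows G1) U \<and> a \<in> U \<and>
        continuous_map (subtopology (arrows G1) U) ?Y g \<and> (\<forall>b\<in>U. arrow_map b = g b)"
      by blast
  qed
  moreover have "arrows G2 = subtopology ?Y {(z', A, z). gdom (universal_groupoid T) A = f2 z \<and>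
      grng (universal_groupoid T) A = f2 z'}"
    by (simp add: pullback_groupoid_def)
  ultimately show ?thesis
    using arrow_map_arrow by (auto simp: continuous_map_in_subtopology)
qed

text \<open>With \<open>x'\<close> over the middle unit, the product of the images has an extra
  \<open>lprod x' x'\<close> between the two elements of \<open>S\<close>. The germ does not see it,
  because \<open>f1\<close> at the middle unit is 1 there.\<close>

lemma arrow_map_comp:
  assumes "(a, b) \<in> composable G1"
  shows "arrow_map (gcomp G1 a b) = gcomp G2 (arrow_map a) (arrow_map b)"
proof -
  obtain z'' A y where a: "a = (z'', A, y)" by (cases a)
  obtain z' B z where b: "b = (z', B, z)" by (cases b)
  have "y = z'" "a \<in> topspace (arrows G1)" "b \<in> topspace (arrows G1)"
    using assms a b by (auto simp: composable_def pullback_groupoid_def)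
  then obtain s r where
    r: "z' \<in> topspace Z" "z'' \<in> topspace Z" "(r, f1 z') \<in> germ_pairs S"
      "char_act S r (f1 z') = f1 z''" "A = germ S r (f1 z')"
    and s: "z \<in> topspace Z" "z' \<in> topspace Z" "(s, f1 z) \<in> germ_pairs S"
      "char_act S s (f1 z) = f1 z'" "B = germ S s (f1 z)"
    using a b pullback_arrow_cases by metis
  let ?x = "\<xi> z" and ?x' = "\<xi> z'" and ?x'' = "\<xi> z''"
  note c = S.germ_pairsD(1)[OF r(3)] S.germ_pairsD(1)[OF s(3)]
  have AB: "gcomp (universal_groupoid S) A B = germ S (r \<otimes>\<^bsub>S\<^esub> s) (f1 z)"
    using S.gcomp_germ[of r s "f1 z"] r s by simp
  have rs: "z \<in> topspace Z" "z'' \<in> topspace Z" "(r \<otimes>\<^bsub>S\<^esub> s, f1 z) \<in> germ_pairs S"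
    "char_act S (r \<otimes>\<^bsub>S\<^esub> s) (f1 z) = f1 z''"
    using r s c S.germ_pairs_mult[of r s "f1 z"] by (simp_all add: S.char_act_mult)
  have e: "f1 z' (lprod ?x' ?x')"
    using transport_char_dom[OF \<xi>_X f2_char_dom] f1_eq r(1) by (simp add: char_dom_def)
  have "(r \<otimes>\<^bsub>S\<^esub> lprod ?x' ?x' \<otimes>\<^bsub>S\<^esub> s, f1 z) \<in> germ S (r \<otimes>\<^bsub>S\<^esub> s) (f1 z)"
  proof -
    \<comment> \<open>The inserted idempotent, moved through \<open>s\<close> to the right;
      \<open>f1 z\<close> is 1 there since \<open>s\<close> sends \<open>f1 z\<close> to
      \<open>f1 z'\<close>.\<close>
    let ?k = "star S s \<otimes>\<^bsub>S\<^esub> lprod ?x' ?x' \<otimes>\<^bsub>S\<^esub> s"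
    have k: "?k \<in> idems S" "f1 z ?k"
      using c r(1) e s(4)[symmetric] by simp_all
    have rk: "r \<otimes>\<^bsub>S\<^esub> s \<otimes>\<^bsub>S\<^esub> ?k = r \<otimes>\<^bsub>S\<^esub> lprod ?x' ?x' \<otimes>\<^bsub>S\<^esub> s"
      using c r(1) by (simp add: S.m_assoc S.idem_mult_star_cancel)
    from S.germ_mult_idem[OF rs(3) k] show ?thesis unfolding rk .
  qed
  then have "germ T (rprod ?x'' (lact (r \<otimes>\<^bsub>S\<^esub> lprod ?x' ?x' \<otimes>\<^bsub>S\<^esub> s) ?x)) (f2 z) =
      germ T (rprod ?x'' (lact (r \<otimes>\<^bsub>S\<^esub> s) ?x)) (f2 z)"
    by (rule arrow_pullback(3)[OF rs])
  moreover have "rprod ?x'' (lact r ?x') \<otimes>\<^bsub>T\<^esub> rprod ?x' (lact s ?x) =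
      rprod ?x'' (lact (r \<otimes>\<^bsub>S\<^esub> lprod ?x' ?x' \<otimes>\<^bsub>S\<^esub> s) ?x)"
    using c r s by (simp add: rprod_mult lprod_lact lact_mult)
  moreover have "gcomp (universal_groupoid T) (germ T (rprod ?x'' (lact r ?x')) (f2 z'))
      (germ T (rprod ?x' (lact s ?x)) (f2 z)) =
      germ T (rprod ?x'' (lact r ?x') \<otimes>\<^bsub>T\<^esub> rprod ?x' (lact s ?x)) (f2 z)"
    using T.gcomp_germ[of "rprod ?x'' (lact r ?x')" "rprod ?x' (lact s ?x)" "f2 z"]
      arrow_pullback(1,2)[OF r(1-4)] arrow_pullback(1,2)[OF s(1-4)] by simp
  ultimately show ?thesis
    using arrow_map_germ[OF r(1-4)] arrow_map_germ[OF s(1-4)] arrow_map_germ[OF rs] a b r(5) s(5)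
      \<open>y = z'\<close> AB
    by (simp add: pullback_groupoid_def)
qed

lemma arrow_map_id:
  assumes z: "z \<in> topspace Z"
  shows "arrow_map (gid G1 z) = gid G2 z"
proof -
  let ?x = "\<xi> z"
  have f1: "f1 z \<in> characters S" "f1 z (lprod ?x ?x)"
    using transport_char_dom[OF \<xi>_X f2_char_dom] f1_eq z by (simp_all add: char_dom_def)
  have f2: "f2 z \<in> characters T" "f2 z (rprod ?x ?x)"
    using f2_char_dom z by (auto simp: char_dom_def)
  have "gid (universal_groupoid S) (f1 z) = germ S (lprod ?x ?x) (f1 z)"
    using f1 z by (intro S.gid_eq_germ) simp_all
  moreover have "gid (universal_groupoid T) (f2 z) = germ T (rprod ?x ?x) (f2 z)"
    using f2 z by (intro T.gid_eq_germ) simp_all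
  moreover have "arrow_map (z, germ S (lprod ?x ?x) (f1 z), z) = (z, germ T (rprod ?x ?x) (f2 z), z)"
    using arrow_map_germ[of z z "lprod ?x ?x"] z f1 by (simp add: S.germ_pairs_idem S.char_act_idem)
  ultimately show ?thesis by (simp add: pullback_groupoid_def)
qed

text \<open>The outer map is the arrow map of the swapped bundle, written with its parameters. The
  identity for the other composite is the swapped instance of this one.\<close>

lemma swap_arrow_map:
  assumes "a \<in> topspace (arrows G1)"
  shows "morita_bundle.arrow_map S (\<lambda>t x. ract x (star T t)) lprod \<xi> f1 (arrow_map a) = a"
proof -
  interpret swap: morita_bundle T S X "\<lambda>t x. ract x (star T t)" "\<lambda>x s. lact (star S s) x" rprod lprod
    Z \<xi> f2 f1
    by (rule swap_bundle)
  obtain z' A z where a: "a = (z', A, z)" by (cases a)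
  then obtain s where s: "z \<in> topspace Z" "z' \<in> topspace Z" "(s, f1 z) \<in> germ_pairs S"
    "char_act S s (f1 z) = f1 z'" "A = germ S s (f1 z)"
    using assms pullback_arrow_cases by blast
  have "germ S (lprod (\<xi> z') (ract (\<xi> z) (star T (rprod (\<xi> z') (lact s (\<xi> z)))))) (f1 z) = germ S s (f1 z)"
    using pullback_inverse[of "\<xi> z" "\<xi> z'" s "f2 z" "f2 z'"] s f1_eq f2_char_dom by simp
  then show ?thesis
    using arrow_map_germ[OF s(1-4)] swap.arrow_map_germ[OF s(1,2) arrow_pullback(1,2)[OF s(1-4)]] a s(5)
    by simp
qed

lemma pullback_isomorphic: "topologically_isomorphic G1 G2"
proof -
  interpret swap: morita_bundle T S X "\<lambda>t x. ract x (star T t)" "\<lambda>x s. lact (star S s) x" rprod lprod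
    Z \<xi> f2 f1
    by (rule swap_bundle)
  \<comment> \<open>Swapping twice gives the action of \<open>star S (star S s)\<close>, which is
    known to be that of \<open>s\<close> when \<open>s\<close> is in the carrier; so the chosen
    representative has to be located there.\<close>
  have star_star: "morita_bundle.arrow_map T (\<lambda>s x. lact (star S (star S s)) x) rprod \<xi> f2 a = arrow_map a"
    if a: "a \<in> topspace (arrows G1)" for a
  proof -
    obtain z' A z where a': "a = (z', A, z)" by (cases a)
    then obtain s where s: "(s, f1 z) \<in> germ_pairs S" "A = germ S s (f1 z)"
      using a pullback_arrow_cases by blast
    have "\<exists>\<rho>. (SOME r. \<exists>\<rho>. (r, \<rho>) \<in> A, \<rho>) \<in> A"
      by (rule someI_ex) (use s S.germ_self[OF s(1)] in blast)
    then have "(SOME r. \<exists>\<rho>. (r, \<rho>) \<in> A) \<in> carrier S"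
      using s S.mem_germ_iff S.germ_pairsD(1) by blast
    then show ?thesis
      by (simp add: morita_bundle.arrow_map_def[OF swap.swap_bundle] arrow_map_def a')
  qed
  have "homeomorphic_maps (arrows G1) (arrows G2) arrow_map swap.arrow_map"
    unfolding homeomorphic_maps_def
    using continuous_arrow_map swap.continuous_arrow_map swap_arrow_map swap.swap_arrow_map
      star_star swap.arrow_map_arrow by auto
  then have "homeomorphic_map (arrows G1) (arrows G2) arrow_map"
    by (rule homeomorphic_maps_imp_map)
  moreover have "gdom G2 (arrow_map a) = gdom G1 a \<and> grng G2 (arrow_map a) = grng G1 a" for a
    by (cases a) (simp add: arrow_map_def pullback_groupoid_def)
  moreover have "units G1 = Z" "units G2 = Z"
    by (simp_all add: pullback_groupoid_def)
  ultimately show ?thesis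
    unfolding topologically_isomorphic_def
    using arrow_map_comp arrow_map_id by (intro exI[of _ arrow_map] exI[of _ id]) auto
qed

end

section \<open>The equivalence\<close>

text \<open>Moves a space into another type by pulling its topology back along the inverse of an
  injection. This brings \<open>Z\<close> into the type that \<open>morita_equivalent\<close>
  prescribes.\<close>

lemma homeomorphic_copy:
  fixes i :: "'a \<Rightarrow> 'b"
  assumes i: "inj_on i (topspace Y)"
  obtains Z :: "'b topology" and j where "homeomorphic_map Z Y j"
proof
  let ?j = "inv_into (topspace Y) i"
  let ?Z = "pullback_topology (i ` topspace Y) ?j Y"
  have j: "?j (i y) = y" if "y \<in> topspace Y" for y
    using that i by simp
  have "homeomorphic_maps ?Z Y ?j i"
    unfolding homeomorphic_maps_def
  proof (intro conjI ballI)
    show "continuous_map ?Z Y ?j"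
      using continuous_map_pullback[OF continuous_map_id, of "i ` topspace Y" ?j Y] by simp
    show "continuous_map Y ?Z i"
    proof (rule continuous_map_pullback')
      show "continuous_map Y Y (?j \<circ> i)"
        by (rule continuous_map_eq[OF continuous_map_id]) (simp add: j)
    qed auto
    show "?j (i y) = y" if "y \<in> topspace Y" for y
      using that by (rule j)
    show "i (?j z) = z" if "z \<in> topspace ?Z" for z
      using that by (auto simp: topspace_pullback_topology f_inv_into_f)
  qed
  then show "homeomorphic_map ?Z Y ?j" by (rule homeomorphic_maps_imp_map)
qed

lemma lc_hausdorff_open_subset:
  assumes "lc_hausdorff Z" "openin Z U"
  shows "lc_hausdorff (subtopology Z U)"
  using assms by (auto simp: lc_hausdorff_def intro: locally_compact_space_open_subset Hausdorff_space_subtopology)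

lemma lc_hausdorff_imp_locally:
  assumes "lc_hausdorff Z"
  shows "locally_lc_hausdorff Z"
  unfolding locally_lc_hausdorff_def
proof (intro exI conjI)
  show "openin Z = arbitrary union_of (\<lambda>U. U \<in> Collect (openin Z))"
    by (subst openin_topology_base_unique) auto
qed (use assms lc_hausdorff_open_subset in auto)

lemma open_surjection_compose:
  assumes "homeomorphic_map Z Y j" "open_surjection Y W f"
  shows "open_surjection Z W (f \<circ> j)"
  using assms unfolding open_surjection_def homeomorphic_eq_everything_map
  by (auto intro: continuous_map_compose open_map_compose simp flip: image_image)

context morita_context
begin

text \<open>If \<open>f = rprod a b\<close>, then \<open>lact (lprod b b) a\<close> has self-pairing
  \<open>f \<otimes> star T f\<close>. As each character is 1 at some idempotent, this makes the
  unit maps surjective.\<close>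

lemma idem_eq_rprod:
  assumes "f \<in> idems T"
  obtains x where "x \<in> X" "rprod x x = f"
proof -
  have "f \<in> carrier T" using assms by simp
  then obtain a b where ab: "a \<in> X" "b \<in> X" "f = rprod a b"
    unfolding rprod_onto[symmetric] by auto
  have "rprod (lact (lprod b b) a) (lact (lprod b b) a) = rprod a (lact (lprod b b) a)"
    using ab by (simp add: rprod_lact flip: lact_mult)
  also have "\<dots> = f \<otimes>\<^bsub>T\<^esub> star T f"
    using ab by (simp add: rprod_mult)
  also have "\<dots> = f" using assms by simp
  finally show ?thesis using ab by (intro that) simp_all
qed

interpretation swap: morita_context T S X "\<lambda>t x. ract x (star T t)" "\<lambda>x s. lact (star S s) x" rprod lprod
  by (rule swap)

text \<open>The mirror image of \<open>transport_swap_transport\<close>, up to a doubled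
  \<open>star\<close>, which cancels on idempotents.\<close>

lemma swap_transport_transport:
  assumes x: "x \<in> X" and \<rho>: "\<rho> \<in> char_dom S (lprod x x)"
  shows "transport x (swap.transport x \<rho>) = \<rho>"
proof -
  have "morita_context.transport S (\<lambda>s x. lact (star S (star S s)) x) rprod x (swap.transport x \<rho>) =
      transport x (swap.transport x \<rho>)"
    unfolding transport_def morita_context.transport_def[OF swap.swap] by (auto intro!: restrict_ext)
  then show ?thesis using swap.transport_swap_transport[OF x \<rho>] by simp
qed

text \<open>The image is the preimage under the continuous inverse map, taken inside the open set
  \<open>char_dom S (lprod x x)\<close>.\<close>

lemma open_transport_image:
  assumes x: "x \<in> X" and U: "openin (character_space T) U" "U \<subseteq> char_dom T (rprod x x)"
  shows "openin (character_space S) (transport x ` U)"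
proof -
  have "transport x ` U = {\<rho> \<in> char_dom S (lprod x x). swap.transport x \<rho> \<in> U}"
  proof (intro equalityI subsetI)
    fix \<rho> assume "\<rho> \<in> transport x ` U"
    then show "\<rho> \<in> {\<rho> \<in> char_dom S (lprod x x). swap.transport x \<rho> \<in> U}"
      using U(2) transport_char_dom[OF x] transport_swap_transport[OF x] by auto
  next
    fix \<rho> assume "\<rho> \<in> {\<rho> \<in> char_dom S (lprod x x). swap.transport x \<rho> \<in> U}"
    then show "\<rho> \<in> transport x ` U"
      using swap_transport_transport[OF x] by (auto intro: rev_image_eqI)
  qed
  then show ?thesis
    using openin_continuous_map_preimage[OF swap.continuous_map_transport[OF x] U(1)] x
    by (simp add: openin_open_subtopology)
qed

theorem morita_equivalent_universal_groupoids:
  "morita_equivalent (universal_groupoid S) (universal_groupoid T)"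
proof -
  \<comment> \<open>A base point for each idempotent \<open>f\<close> of \<open>T\<close>; every
    \<open>x\<close> with \<open>rprod x x = f\<close> is an \<open>S\<close>-multiple of
    it.\<close>
  define y where "y f = (SOME x. x \<in> X \<and> rprod x x = f)" for f
  have y: "y f \<in> X \<and> rprod (y f) (y f) = f" if "f \<in> idems T" for f
    unfolding y_def by (rule someI_ex) (use idem_eq_rprod[OF that] in blast)
  define K where "K = carrier S \<times> idems T"
  define \<xi> where "\<xi> = (\<lambda>(s, f). lact s (y f))"
  have \<xi>: "\<xi> k \<in> X" if "k \<in> K" for k
    using that y by (auto simp: K_def \<xi>_def)
  \<comment> \<open>\<open>x\<close> is recovered from \<open>\<langle>x, y\<^sub>f\<rangle>\<close> and \<open>f = [x, x]\<close>; so \<open>X\<close> can be indexed by pairs in \<open>S \<times> T\<close>,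
    which is what makes \<open>Z\<close> fit into the type of pairs of germs.\<close>
  have \<xi>_onto: "\<exists>k\<in>K. \<xi> k = x" if x: "x \<in> X" for x
  proof (rule bexI[of _ "(lprod x (y (rprod x x)), rprod x x)"])
    show "\<xi> (lprod x (y (rprod x x)), rprod x x) = x"
      using x y[of "rprod x x"] by (simp add: \<xi>_def lprod_rprod)
    show "(lprod x (y (rprod x x)), rprod x x) \<in> K"
      using x y[of "rprod x x"] by (simp add: K_def)
  qed
  let ?D = "\<lambda>k. char_dom T (rprod (\<xi> k) (\<xi> k))"
  let ?P = "prod_topology (discrete_topology K) (character_space T)"
  \<comment> \<open>The disjoint union is realised as an open part of a product with discrete first
    factor, from which it inherits local compactness and the Hausdorff property. If
    \<open>\<xi>\<close> takes a value twice on \<open>K\<close>, a slice is merely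
    repeated.\<close>
  define Y where "Y = subtopology ?P (SIGMA k:K. ?D k)"
  have slice: "openin ?P ({k} \<times> ?D k)" if "k \<in> K" for k
    using that \<xi> by (simp add: openin_prod_Times_iff)
  have "(SIGMA k:K. ?D k) = (\<Union>k\<in>K. {k} \<times> ?D k)" by auto
  then have openD: "openin ?P (SIGMA k:K. ?D k)"
    using slice by (auto intro!: openin_Union)
  have topY: "topspace Y = (SIGMA k:K. ?D k)"
    by (auto simp: Y_def char_dom_def)
  have openY: "openin ?P W" if "openin Y W" for W
    using that openD by (simp add: Y_def openin_open_subtopology)
  have lcP: "lc_hausdorff ?P"
    using T.lc_hausdorff_character_space
    by (auto simp: lc_hausdorff_def locally_compact_space_prod_topology Hausdorff_space_prod_topology
        locally_compact_space_discrete_topology)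
  have lcY: "lc_hausdorff Y"
    unfolding Y_def by (rule lc_hausdorff_open_subset[OF lcP openD])
  define f1 where "f1 = (\<lambda>(k, \<phi>). transport (\<xi> k) \<phi>)"
  have cont_fst: "continuous_map Y (discrete_topology K) fst"
    unfolding Y_def by (intro continuous_map_from_subtopology continuous_map_fst)
  have cont_snd: "continuous_map Y (character_space T) snd"
    unfolding Y_def by (intro continuous_map_from_subtopology continuous_map_snd)
  have f2: "open_surjection Y (character_space T) snd"
    unfolding open_surjection_def
  proof (intro conjI cont_snd)
    show "open_map Y (character_space T) snd"
      using openY open_map_snd[of "discrete_topology K" "character_space T"] by (auto simp: open_map_def)
    show "snd ` topspace Y = topspace (character_space T)"
    proof
      show "snd ` topspace Y \<subseteq> topspace (character_space T)"
        by (auto simp: topY char_dom_def)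
      show "topspace (character_space T) \<subseteq> snd ` topspace Y"
      proof
        fix \<phi> assume "\<phi> \<in> topspace (character_space T)"
        then have \<phi>: "\<phi> \<in> characters T" by simp
        then obtain f where f: "f \<in> idems T" "\<phi> f" using T.characterD(2) by blast
        obtain k where "k \<in> K" "\<xi> k = y f" using \<xi>_onto y[OF f(1)] by blast
        then have "(k, \<phi>) \<in> topspace Y"
          using f \<phi> y[OF f(1)] by (simp add: topY char_dom_def)
        then show "\<phi> \<in> snd ` topspace Y" by force
      qed
    qed
  qed
  have f1: "open_surjection Y (character_space S) f1"
    unfolding open_surjection_def
  proof (intro conjI)
    show "continuous_map Y (character_space S) f1"
    proof (rule continuous_map_locallyI)
      fix a assume a: "a \<in> topspace Y"
      then obtain k \<phi> where k: "a = (k, \<phi>)" "k \<in> K" "\<phi> \<in> ?D k"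
        by (auto simp: topY)
      let ?U = "{k} \<times> ?D k"
      have "openin Y ?U"
        using slice[OF k(2)] k(2) openD by (auto simp: Y_def openin_open_subtopology)
      moreover have "continuous_map (subtopology Y ?U) (character_space S) (transport (\<xi> k) \<circ> snd)"
      proof (rule continuous_map_compose[OF _ continuous_map_transport[OF \<xi>[OF k(2)]]])
        show "continuous_map (subtopology Y ?U) (subtopology (character_space T) (?D k)) snd"
          using cont_snd by (intro continuous_map_into_subtopology continuous_map_from_subtopology) auto
      qed
      ultimately show "\<exists>U g. openin Y U \<and> a \<in> U \<and> continuous_map (subtopology Y U) (character_space S) g \<and>
          (\<forall>b\<in>U. f1 b = g b)"
        using k by (intro exI[of _ ?U] exI[of _ "transport (\<xi> k) \<circ> snd"]) (auto simp: f1_def)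
    qed
    show "open_map Y (character_space S) f1"
      unfolding open_map_def
    proof (intro allI impI)
      fix W assume W: "openin Y W"
      \<comment> \<open>The slice of \<open>W\<close> over the index \<open>k\<close>, on which
        \<open>f1\<close> is a single transport and hence open.\<close>
      define V where "V k = {\<phi> \<in> topspace (character_space T). (k, \<phi>) \<in> W}" for k
      have "openin (character_space T) (V k)" if "k \<in> K" for k
        unfolding V_def
      proof (rule openin_continuous_map_preimage[OF _ openY[OF W]])
        show "continuous_map (character_space T) ?P (Pair k)"
          using that by (intro continuous_map_pairedI) auto
      qed
      moreover have WD: "W \<subseteq> (SIGMA k:K. ?D k)"
        using openin_subset[OF W] topY by simp
      then have "V k \<subseteq> ?D k" for k by (auto simp: V_def)
      ultimately have "openin (character_space S) (transport (\<xi> k) ` V k)" if "k \<in> K" for k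
        using that \<xi> by (intro open_transport_image) auto
      moreover have "f1 ` W = (\<Union>k\<in>K. transport (\<xi> k) ` V k)"
      proof
        show "f1 ` W \<subseteq> (\<Union>k\<in>K. transport (\<xi> k) ` V k)"
          using WD by (fastforce simp: f1_def V_def char_dom_def)
        show "(\<Union>k\<in>K. transport (\<xi> k) ` V k) \<subseteq> f1 ` W"
          by (force simp: f1_def V_def)
      qed
      ultimately show "openin (character_space S) (f1 ` W)"
        by (auto intro!: openin_Union)
    qed
    show "f1 ` topspace Y = topspace (character_space S)"
    proof
      show "f1 ` topspace Y \<subseteq> topspace (character_space S)"
        using transport_char_dom \<xi> by (fastforce simp: topY f1_def char_dom_def)
      show "topspace (character_space S) \<subseteq> f1 ` topspace Y"
      proof
        fix \<rho> assume "\<rho> \<in> topspace (character_space S)"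
        then have \<rho>: "\<rho> \<in> characters S" by simp
        then obtain e where e: "e \<in> idems S" "\<rho> e" using S.characterD(2) by blast
        obtain x where x: "x \<in> X" "lprod x x = e"
          using swap.idem_eq_rprod[OF e(1)] by blast
        then have \<rho>': "\<rho> \<in> char_dom S (lprod x x)" using \<rho> e by (simp add: char_dom_def)
        obtain k where k: "k \<in> K" "\<xi> k = x" using \<xi>_onto x(1) by blast
        then have "(k, swap.transport x \<rho>) \<in> topspace Y"
          using swap.transport_char_dom[OF x(1) \<rho>'] by (simp add: topY)
        moreover have "f1 (k, swap.transport x \<rho>) = \<rho>"
          using swap_transport_transport[OF x(1) \<rho>'] k by (simp add: f1_def)
        ultimately show "\<rho> \<in> f1 ` topspace Y" by (metis rev_image_eqI)
      qed
    qed
  qed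
  \<comment> \<open>Any injection into the prescribed type will do: the values are singletons rather
    than actual germs, and \<open>undefined\<close> fills the slot for a function on
    \<open>'s\<close>.\<close>
  define i :: "('s \<times> 't) \<times> ('t \<Rightarrow> bool) \<Rightarrow> 's germ_class \<times> 't germ_class"
    where "i = (\<lambda>((s, f), \<phi>). ({(s, undefined)}, {(f, \<phi>)}))"
  have "inj_on i (topspace Y)" by (auto simp: inj_on_def i_def)
  then obtain Z :: "('s germ_class \<times> 't germ_class) topology" and j where j: "homeomorphic_map Z Y j"
    by (rule homeomorphic_copy)
  have jY: "j z \<in> topspace Y" if "z \<in> topspace Z" for z
    using that j homeomorphic_imp_surjective_map by fastforce
  have "lc_hausdorff Z"
    using lcY homeomorphic_map_imp_homeomorphic_space[OF j] homeomorphic_locally_compact_space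
      homeomorphic_Hausdorff_space unfolding lc_hausdorff_def by blast
  then have lcZ: "locally_lc_hausdorff Z" by (rule lc_hausdorff_imp_locally)
  note g1 = open_surjection_compose[OF j f1] and g2 = open_surjection_compose[OF j f2]
  interpret morita_bundle S T X lact ract lprod rprod Z "\<xi> \<circ> fst \<circ> j" "f1 \<circ> j" "snd \<circ> j"
  proof
    have "continuous_map (discrete_topology K) (discrete_topology X) \<xi>"
      using \<xi> by (auto simp: continuous_map_def)
    then show "continuous_map Z (discrete_topology X) (\<xi> \<circ> fst \<circ> j)"
      using cont_fst j homeomorphic_imp_continuous_map by (metis continuous_map_compose comp_assoc)
    show "continuous_map Z (character_space S) (f1 \<circ> j)" "continuous_map Z (character_space T) (snd \<circ> j)"
      using g1 g2 by (simp_all add: open_surjection_def)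
    fix z assume "z \<in> topspace Z"
    then have "j z \<in> topspace Y" by (rule jY)
    then show "(snd \<circ> j) z (rprod ((\<xi> \<circ> fst \<circ> j) z) ((\<xi> \<circ> fst \<circ> j) z))"
      "(f1 \<circ> j) z = transport ((\<xi> \<circ> fst \<circ> j) z) ((snd \<circ> j) z)"
      by (auto simp: topY f1_def char_dom_def split: prod.splits)
  qed
  show ?thesis
    unfolding morita_equivalent_def
    using S.etale_groupoid_universal T.etale_groupoid_universal lcZ g1 g2 pullback_isomorphic
    by (auto simp del: o_apply)
qed

end

theorem theorem4p7:
  fixes S :: "'s sgrp" and T :: "'t sgrp"
  assumes "inverse_semigroup S" and "inverse_semigroup T"
    and "countable (carrier S)" and "countable (carrier T)"
    and "strongly_morita_equivalent TYPE('x) S T"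
  shows "morita_equivalent (universal_groupoid S) (universal_groupoid T)"
  using assms(5) morita_context.morita_equivalent_universal_groupoids
  unfolding strongly_morita_equivalent_def by blast

end
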